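(* Let $G$ be a circulant graph with property $Q$ and let $H$ be any Hamilton cycle decomposable (loopless) multigraph. Then the tensor product $G\times H$ is Hamilton cycle decomposable.
   Context: A circulant $X=Circ(n;L)$, with $L\subseteq\{1,2,\ldots,\lfloor n/2\rfloor\}$ (the elements of $L$ are called jumps), has vertex set $\{u_0,\ldots,u_{n-1}\}$ and edge set $\{u_iu_{i+\ell}: i\in\mathbb{Z}_n,\ \ell\in L\}$ (indices mod $n$). An even regular circulant graph $X=Circ(n;L)$ has property $Q$ if (1) the number of odd jumps and the number of even jumps in $L$ are equal, and (2) the odd jumps can be paired with the even jumps so that each of the $|L|/2$ resulting $4$-regular circulant graphs $Circ(n;\{\ell,\ell'\})$ ($\ell$ odd, $\ell'$ even, a pair) is connected. A Hamilton cycle decomposition of a (multi)graph is a partition of its edge set into Hamilton cycles. For a multigraph $H$ (an edge may have multiplicity), the tensor product $G\times H$ has vertex set $V(G)\times V(H)$; for each edge $g_1g_2$ of $G$ and each edge $h_1h_2$ of $H$ of multiplicity $\mu$, there are edges $(g_1,h_1)(g_2,h_2)$ and $(g_1,h_2)(g_2,h_1)$, each of multiplicity $\mu$; for simple graphs, $(g_1,h_1)$ and $(g_2,h_2)$ are adjacent iff $g_1g_2\in E(G)$ and $h_1h_2\in E(H)$. *)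

theory Defs
  imports "HOL-Library.Multiset"
begin

text \<open>An edge is the set of its end vertices; parallel edges are recorded by the multiplicity in
  \<^term>\<open>edges\<close>.\<close>

record 'a multigraph =
  verts :: "'a set"
  edges :: "'a set multiset"

definition loopless_multigraph :: "'a multigraph \<Rightarrow> bool" where
  "loopless_multigraph G \<longleftrightarrow>
     finite (verts G) \<and> (\<forall>e \<in># edges G. e \<subseteq> verts G \<and> card e = 2)"

definition vertex_degree :: "'a multigraph \<Rightarrow> 'a \<Rightarrow> nat" where
  "vertex_degree G v = size {#e \<in># edges G. v \<in> e#}"

definition regular_graph :: "nat \<Rightarrow> 'a multigraph \<Rightarrow> bool" where
  "regular_graph k G \<longleftrightarrow> (\<forall>v \<in> verts G. vertex_degree G v = k)"

definition connected_graph :: "'a multigraph \<Rightarrow> bool" where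
  "connected_graph G \<longleftrightarrow>
     (\<forall>u \<in> verts G. \<forall>v \<in> verts G. (u, v) \<in> {(x, y). {x, y} \<in># edges G}\<^sup>*)"

text \<open>For two vertices \<open>[a, b]\<close> this is the 2-cycle consisting of two parallel edges \<open>{a, b}\<close>.\<close>

definition cycle_edges :: "'a list \<Rightarrow> 'a set multiset" where
  "cycle_edges vs =
     {#{vs ! i, vs ! (Suc i mod length vs)}. i \<in># mset_set {..<length vs}#}"

definition hamilton_cycle :: "'a multigraph \<Rightarrow> 'a set multiset \<Rightarrow> bool" where
  "hamilton_cycle G C \<longleftrightarrow> C \<subseteq># edges G \<and>
     (\<exists>vs. 2 \<le> length vs \<and> distinct vs \<and> set vs = verts G \<and> C = cycle_edges vs)"

definition hamilton_decomposable :: "'a multigraph \<Rightarrow> bool" where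
  "hamilton_decomposable G \<longleftrightarrow>
     (\<exists>D. (\<forall>C \<in># D. hamilton_cycle G C) \<and> \<Sum>\<^sub># D = edges G)"

definition circ :: "nat \<Rightarrow> nat set \<Rightarrow> nat multigraph" where
  "circ n L = \<lparr>verts = {..<n}, edges = mset_set {{i, (i + l) mod n} | i l. i < n \<and> l \<in> L}\<rparr>"

definition property_Q :: "nat \<Rightarrow> nat set \<Rightarrow> bool" where
  "property_Q n L \<longleftrightarrow>
     (\<exists>k. even k \<and> regular_graph k (circ n L)) \<and>
     card {l \<in> L. odd l} = card {l \<in> L. even l} \<and>
     (\<exists>p. bij_betw p {l \<in> L. odd l} {l \<in> L. even l} \<and>
          (\<forall>l \<in> {l \<in> L. odd l}. regular_graph 4 (circ n {l, p l}) \<and> connected_graph (circ n {l, p l})))"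

text \<open>For \<open>e = {g1, g2}\<close> and \<open>f = {h1, h2}\<close>, both with two distinct ends, the inner set consists of the two
  edges \<open>{(g1, h1), (g2, h2)}\<close> and \<open>{(g1, h2), (g2, h1)}\<close>.\<close>

definition tensor :: "'a multigraph \<Rightarrow> 'b multigraph \<Rightarrow> ('a \<times> 'b) multigraph" where
  "tensor G H = \<lparr>verts = verts G \<times> verts H,
     edges = (\<Sum>e\<in>#edges G. \<Sum>f\<in>#edges H.
       mset_set {{(g1, h1), (g2, h2)} | g1 g2 h1 h2. e = {g1, g2} \<and> f = {h1, h2}})\<rparr>"

end

theory Submission
  imports Defs
begin

text \<open>
  The tensor product is additive in both factors, so it suffices to decompose \<open>circ n {a, b}\<close> times a single cycle
  of length \<open>m\<close> into four Hamilton cycles, for \<open>a\<close> odd and \<open>b\<close> even. Such a cycle may go around the \<open>m\<close> layers using a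
  permutation of \<open>{..<n}\<close> from each layer to the next one, as long as the composite of these permutations is an
  \<open>n\<close>-cycle. Alternating a permutation with its inverse shortens the cycle by two layers, hence only \<open>m = 1\<close> and
  \<open>m = 2\<close> matter. In these cases the four permutations come from the two orientations of two Hamilton cycles
  decomposing the Cayley graph of \<open>Z_n\<close>, respectively of \<open>Z_n \<times> Z_2\<close>, with generators \<open>(a, 1)\<close> and \<open>(b, 1)\<close>; the
  latter graph is connected because \<open>a - b\<close> is odd.

  The Cayley graph is a twisted toroidal grid. As in the theorem of Bermond, Favaron and Maheo, its edges are
  coloured by their generator and the colours are exchanged on suitably placed unit squares. This keeps both
  colour classes 2-regular, so that it is enough to make both of them connected.
\<close>

section \<open>Transitive permutations and Hamilton cycles\<close>

text \<open>In the tensor product both \<open>+ l\<close> and \<open>- l\<close> must lead to the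
  next layer. Stepping back along \<open>(l, 1)\<close> does so only if \<open>- 1\<close> equals
  \<open>1\<close> modulo the number of layers: this is why the Cayley graph has one or two layers,
  and then both orientations of its Hamilton cycles are admissible.

  The obstacle in the exchange is parity. A chain of squares merges the columns it joins, but a ring
  of squares closed around the torus gives a single cycle only if their number is odd; otherwise the
  arcs alternate and two cycles remain. So an odd number of columns is closed to a ring and an even
  number is left as a chain. The same rule for the row classes asks for \<open>\<gamma> - 1\<close>
  squares on the diagonal, and the even number \<open>c\<close> of remaining squares cancels in
  pairs along the zigzag. The diagonal needs about as many columns as there are row classes;
  interchanging the two generators provides this if necessary.\<close>

definition circulates :: "('a \<Rightarrow> 'a) \<Rightarrow> 'a set \<Rightarrow> bool" where
  "circulates F V \<longleftrightarrow> bij_betw F V V \<and> (\<forall>u\<in>V. \<forall>v\<in>V. \<exists>e. (F ^^ e) u = v)"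

lemma funpow_in:
  assumes "bij_betw F V V" "v \<in> V"
  shows "(F ^^ e) v \<in> V"
  using assms(2) by (induction e) (use assms(1) bij_betwE in auto)

lemma funpow_inj_on:
  assumes "bij_betw F V V"
  shows "inj_on (F ^^ e) V"
proof (induction e)
  case (Suc e)
  have "inj_on F ((F ^^ e) ` V)"
    using assms funpow_in[OF assms] by (meson bij_betw_imp_inj_on image_subsetI inj_on_subset)
  then show ?case using Suc comp_inj_on[OF Suc] by (simp add: comp_def)
qed simp

lemma funpow_return:
  assumes "finite V" "bij_betw F V V" "v \<in> V"
  shows "\<exists>p>0. (F ^^ p) v = v"
proof -
  have "\<not> inj (\<lambda>e. (F ^^ e) v)"
    using assms by (metis finite_subset funpow_in image_subsetI infinite_UNIV_nat finite_imageD)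
  then obtain d e where de: "d < e" "(F ^^ d) v = (F ^^ e) v"
    by (metis (no_types, lifting) injI linorder_neqE_nat)
  then have "(F ^^ d) v = (F ^^ d) ((F ^^ (e - d)) v)"
    by (metis add_diff_cancel_left' funpow_add less_imp_add_positive o_apply)
  then have "v = (F ^^ (e - d)) v"
    using funpow_inj_on[OF assms(2)] assms funpow_in[OF assms(2,3)] by (meson inj_onD)
  then show ?thesis using de by (metis zero_less_diff)
qed

text \<open>Every point of a finite permutation is periodic, so a point that reaches
  \<open>v0\<close> is also reached from \<open>v0\<close>; one common target suffices for
  transitivity.\<close>

lemma circulatesI_hub:
  assumes "finite V" "bij_betw F V V" "v0 \<in> V"
    and hub: "\<And>v. v \<in> V \<Longrightarrow> \<exists>e. (F ^^ e) v = v0"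
  shows "circulates F V"
proof -
  have "\<exists>e. (F ^^ e) u = v" if uv: "u \<in> V" "v \<in> V" for u v
  proof -
    obtain d where d: "(F ^^ d) u = v0" using hub uv by blast
    obtain e where e: "(F ^^ e) v = v0" using hub uv by blast
    obtain p where p: "p > 0" "(F ^^ p) v = v" using funpow_return[OF assms(1,2) uv(2)] by blast
    have per: "(F ^^ (p * l)) v = v" for l
      by (induction l) (use p in \<open>auto simp: funpow_add\<close>)
    \<comment> \<open>After \<open>p * e\<close> steps \<open>v\<close> is back at itself; the first
      \<open>e\<close> of them lead to \<open>v0\<close>, so the others lead from \<open>v0\<close>
      to \<open>v\<close>.\<close>
    have "p * e \<ge> e" using p by simp
    then have "(F ^^ (p * e - e)) v0 = v"
      using e per[of e] by (metis funpow_add le_add_diff_inverse2 o_apply)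
    then show ?thesis using d by (metis funpow_add o_apply)
  qed
  then show ?thesis using assms unfolding circulates_def by blast
qed

lemma circulates_cycle_edges:
  assumes circ: "circulates F V" and fin: "finite V" and ne: "V \<noteq> {}"
  shows "\<exists>vs. length vs = card V \<and> distinct vs \<and> set vs = V \<and>
    cycle_edges vs = {#{v, F v}. v \<in># mset_set V#}"
proof -
  obtain v0 where v0: "v0 \<in> V" using ne by blast
  have bij: "bij_betw F V V" and tr: "\<And>v. v \<in> V \<Longrightarrow> \<exists>e. (F ^^ e) v0 = v"
    using circ v0 unfolding circulates_def by blast+
  define p where "p = (LEAST p. p > 0 \<and> (F ^^ p) v0 = v0)"
  have p: "p > 0" "(F ^^ p) v0 = v0"
    using LeastI_ex[OF funpow_return[OF fin bij v0]] unfolding p_def by auto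
  have pmin: "\<not> (e > 0 \<and> (F ^^ e) v0 = v0)" if "e < p" for e
    using that not_less_Least unfolding p_def by blast
  have inj: "inj_on (\<lambda>e. (F ^^ e) v0) {..<p}"
  proof -
    have "d = e" if "d \<le> e" "e < p" "(F ^^ d) v0 = (F ^^ e) v0" for d e
    proof -
      have "(F ^^ d) v0 = (F ^^ d) ((F ^^ (e - d)) v0)"
        using that by (metis funpow_add le_add_diff_inverse o_apply)
      then have "v0 = (F ^^ (e - d)) v0"
        using funpow_inj_on[OF bij] v0 funpow_in[OF bij v0] by (meson inj_onD)
      then show ?thesis using pmin[of "e - d"] that by force
    qed
    then show ?thesis unfolding inj_on_def by (metis lessThan_iff nat_le_linear)
  qed
  have red: "(F ^^ e) v0 = (F ^^ (e mod p)) v0" for e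
    using funpow_mod_eq[OF p(2)] by simp
  have img: "(\<lambda>e. (F ^^ e) v0) ` {..<p} = V"
  proof
    show "(\<lambda>e. (F ^^ e) v0) ` {..<p} \<subseteq> V" using funpow_in[OF bij v0] by auto
    show "V \<subseteq> (\<lambda>e. (F ^^ e) v0) ` {..<p}"
      using tr red p(1) by (metis (no_types, lifting) imageI lessThan_iff mod_less_divisor subsetI)
  qed
  have cp: "p = card V" using img inj by (metis card_image card_lessThan)
  define vs where "vs = map (\<lambda>e. (F ^^ e) v0) [0..<p]"
  have len: "length vs = p" by (simp add: vs_def)
  have "set vs = V" using img by (simp add: vs_def lessThan_atLeast0)
  moreover have "distinct vs" using inj by (simp add: vs_def distinct_map lessThan_atLeast0)
  moreover have "cycle_edges vs = {#{v, F v}. v \<in># mset_set V#}"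
  proof -
    have "mset_set V = image_mset (\<lambda>e. (F ^^ e) v0) (mset_set {..<p})"
      using image_mset_mset_set[OF inj] img by simp
    moreover have "{vs ! i, vs ! (Suc i mod p)} = {(F ^^ i) v0, F ((F ^^ i) v0)}" if "i < p" for i
      using that red[of "Suc i"] by (simp add: vs_def)
    ultimately show ?thesis unfolding cycle_edges_def len
      by (simp add: multiset.map_comp comp_def) (intro image_mset_cong, simp)
  qed
  ultimately show ?thesis using len cp by blast
qed

text \<open>A walk that never turns back in a 2-regular graph can first repeat a vertex only at its
  start, so by connectedness it is a cycle through \<open>V\<close>. Both orientations are returned
  because each yields its own Hamilton cycle of the tensor product.\<close>

lemma two_regular_connected_circulates:
  fixes R :: "'a \<Rightarrow> 'a \<Rightarrow> bool"
  assumes fin: "finite V" and ne: "V \<noteq> {}"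
    and sym: "\<And>x y. R x y \<Longrightarrow> R y x"
    and dom: "\<And>x y. R x y \<Longrightarrow> x \<in> V"
    and irr: "\<And>x. \<not> R x x"
    and two: "\<And>x. x \<in> V \<Longrightarrow> card {y. R x y} = 2"
    and conn: "\<And>x y. x \<in> V \<Longrightarrow> y \<in> V \<Longrightarrow> R\<^sup>*\<^sup>* x y"
  obtains F F' where "circulates F V" "circulates F' V"
    and "\<And>x. x \<in> V \<Longrightarrow> F (F' x) = x" and "\<And>x. x \<in> V \<Longrightarrow> F' (F x) = x"
    and "\<And>x. x \<in> V \<Longrightarrow> {y. R x y} = {F x, F' x}" and "\<And>x. x \<in> V \<Longrightarrow> F x \<noteq> F' x"
proof -
  obtain v0 where v0: "v0 \<in> V" using ne by blast
  then obtain v1 where v1: "R v0 v1" using two[OF v0] by (metis card.empty empty_Collect_eq zero_neq_numeral)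
  have "\<exists>z. R y x \<longrightarrow> R y z \<and> z \<noteq> x \<and> {u. R y u} = {x, z}" for x y
  proof (cases "R y x")
    case True
    then obtain p q where pq: "{u. R y u} = {p, q}" "p \<noteq> q"
      using two[OF dom[OF True]] by (auto simp: card_2_iff)
    then show ?thesis using True by (metis (mono_tags, lifting) insertCI insertE insert_commute mem_Collect_eq singletonD)
  qed simp
  then have "\<forall>x y. \<exists>z. R y x \<longrightarrow> R y z \<and> z \<noteq> x \<and> {u. R y u} = {x, z}" by blast
  then obtain oth where oth: "\<And>x y. R y x \<Longrightarrow> R y (oth x y) \<and> oth x y \<noteq> x \<and> {u. R y u} = {x, oth x y}"
    unfolding choice_iff by blast
  \<comment> \<open>The state consists of the last two vertices; \<open>oth x y\<close> is the
    neighbour of \<open>y\<close> other than \<open>x\<close>.\<close>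
  define pr where "pr = rec_nat (v0, v1) (\<lambda>_ e. (snd e, oth (fst e) (snd e)))"
  define w where "w i = fst (pr i)" for i
  have pr_Suc: "pr (Suc i) = (snd (pr i), oth (fst (pr i)) (snd (pr i)))" for i
    by (simp add: pr_def)
  have wS: "w (Suc i) = snd (pr i)" for i by (simp add: w_def pr_Suc)
  have w2: "w (Suc (Suc i)) = oth (w i) (w (Suc i))" for i
    by (simp add: w_def pr_Suc)
  have wR: "R (w i) (w (Suc i))" for i
  proof (induction i)
    case 0
    show ?case using v1 unfolding wS by (simp add: w_def pr_def)
  next
    case (Suc i)
    then show ?case unfolding w2 using oth sym by blast
  qed
  have wne: "w (Suc (Suc i)) \<noteq> w i" for i unfolding w2 using oth wR sym by blast
  have wnb: "{u. R (w (Suc i)) u} = {w i, w (Suc (Suc i))}" for i unfolding w2 using oth wR sym by blast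
  have wV: "w i \<in> V" for i using wR dom by blast
  define P where "P p \<longleftrightarrow> (\<exists>i<p. w i = w p)" for p
  have "\<not> inj w" using fin wV by (metis finite_subset image_subsetI infinite_UNIV_nat finite_imageD)
  then have "\<exists>p. P p" unfolding P_def by (metis injI linorder_neqE_nat)
  then obtain p where p: "P p" and pmin: "\<And>e. e < p \<Longrightarrow> \<not> P e"
    using exists_least_iff[of P] by blast
  have inj: "i = j" if "w i = w j" "i < p" "j < p" for i j
    using that pmin unfolding P_def by (metis linorder_neqE_nat)
  obtain i where i: "i < p" "w i = w p" using p unfolding P_def by blast
  \<comment> \<open>A later vertex \<open>w i\<close> already has its predecessor and its successor
    on the walk as neighbours; arriving from \<open>w (p - 1)\<close> would add a third one.\<close>
  have i0: "i = 0"
  proof (rule ccontr)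
    assume "i \<noteq> 0"
    then obtain j where j: "i = Suc j" by (cases i) auto
    obtain e where e: "p = Suc e" using i by (cases p) auto
    have "R (w i) (w e)" using wR[of e] sym i e by metis
    then have "w e = w j \<or> w e = w (Suc (Suc j))" using wnb[of j] j by auto
    moreover have "w e \<noteq> w j" using inj[of e j] i e j by auto
    moreover have "w e \<noteq> w (Suc i)"
    proof
      assume we: "w e = w (Suc i)"
      have "Suc i \<noteq> p" using wR[of i] irr i by metis
      then have "e = Suc i" using inj[OF we] i e by auto
      then show False using wne[of i] i e by simp
    qed
    ultimately show False using j by simp
  qed
  have wp: "w p = w 0" using i i0 by simp
  have p3: "p \<ge> 3"
  proof -
    have "p \<noteq> 0" using i by simp
    moreover have "p \<noteq> 1" using wp wR[of 0] irr by auto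
    moreover have "p \<noteq> 2" using wp wne[of 0] by (auto simp: numeral_2_eq_2)
    ultimately show ?thesis by linarith
  qed
  have nb: "{u. R (w i) u} = {w ((i + 1) mod p), w ((i + p - 1) mod p)}" if "i < p" for i
  proof (cases i)
    case 0
    obtain e where e: "p = Suc e" "e \<ge> 2" using p3 by (cases p) auto
    have "R (w 0) (w e)" using wR[of e] sym wp e by metis
    moreover have "{u. R (w 0) u} = {w 1, oth (w 1) (w 0)}" using oth[of "w 0" "w 1"] wR[of 0] by simp
    moreover have "w e \<noteq> w 1" using inj[of e 1] e by auto
    ultimately have "{u. R (w 0) u} = {w 1, w e}" by auto
    then show ?thesis using 0 e by simp
  next
    case (Suc j)
    have "w ((Suc j + 1) mod p) = w (Suc (Suc j))"
      using that Suc wp by (cases "Suc (Suc j) = p") auto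
    moreover have "(Suc j + p - 1) mod p = j" using Suc that by simp
    ultimately show ?thesis using wnb[of j] Suc by auto
  qed
  have img: "w ` {..<p} = V"
  proof
    show "w ` {..<p} \<subseteq> V" using wV by auto
    show "V \<subseteq> w ` {..<p}"
    proof
      fix v assume "v \<in> V"
      then have "R\<^sup>*\<^sup>* (w 0) v" using conn wV by blast
      then show "v \<in> w ` {..<p}"
      proof (induction)
        case base
        then show ?case using p3 by auto
      next
        case (step y z)
        then obtain i where i: "i < p" "y = w i" by auto
        then have "z = w ((i + 1) mod p) \<or> z = w ((i + p - 1) mod p)"
          using nb[OF i(1)] step(2) by auto
        moreover have "p > 0" using p3 by simp
        ultimately show ?case by auto
      qed
    qed
  qed
  define idx where "idx = the_inv_into {..<p} w"
  have winj: "inj_on w {..<p}" using inj by (auto simp: inj_on_def)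
  have idx: "idx (w i) = i" if "i < p" for i
    unfolding idx_def using the_inv_into_f_f[OF winj] that by simp
  define F where "F x = w ((idx x + 1) mod p)" for x
  define F' where "F' x = w ((idx x + p - 1) mod p)" for x
  have ex: "\<exists>i<p. x = w i" if "x \<in> V" for x using that img by auto
  have pp: "e mod p < p" for e using p3 by simp
  have Fw: "F (w i) = w ((i + 1) mod p)" "F' (w i) = w ((i + p - 1) mod p)" if "i < p" for i
    using that by (simp_all add: F_def F'_def idx)
  have FF': "F (F' x) = x" if x: "x \<in> V" for x
  proof -
    obtain i where i: "i < p" "x = w i" using ex x by blast
    have "((i + p - 1) mod p + 1) mod p = (i + p - 1 + 1) mod p" by (rule mod_add_left_eq)
    also have "\<dots> = i" using i by simp
    finally show ?thesis using Fw[OF pp] Fw[OF i(1)] i by simp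
  qed
  have F'F: "F' (F x) = x" if x: "x \<in> V" for x
  proof -
    obtain i where i: "i < p" "x = w i" using ex x by blast
    have "((i + 1) mod p + p - 1) mod p = ((i + 1) mod p + (p - 1)) mod p" using p3 by simp
    also have "\<dots> = (i + 1 + (p - 1)) mod p" by (rule mod_add_left_eq)
    also have "\<dots> = i" using i by simp
    finally show ?thesis using Fw[OF pp] Fw[OF i(1)] i by simp
  qed
  have FV: "F x \<in> V" "F' x \<in> V" for x by (simp_all add: F_def F'_def wV)
  have bij: "bij_betw F V V" "bij_betw F' V V"
    using FF' F'F FV by (auto intro!: bij_betw_byWitness[of V F' F] bij_betw_byWitness[of V F F'])
  have pow: "(F ^^ e) (w i) = w ((i + e) mod p)" if "i < p" for i e
  proof (induction e)
    case 0
    then show ?case using that by simp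
  next
    case (Suc e)
    have "((i + e) mod p + 1) mod p = (i + e + 1) mod p" by (rule mod_add_left_eq)
    then show ?case using Suc Fw[OF pp, of "i + e"] by simp
  qed
  have pow': "(F' ^^ i) (w i) = w 0" if "i < p" for i
    using that
  proof (induction i)
    case (Suc i)
    have "F' (w (Suc i)) = w i" using Fw(2)[OF Suc.prems] Suc.prems by simp
    then show ?case using Suc by (simp add: funpow_swap1)
  qed simp
  have "circulates F V"
  proof (rule circulatesI_hub[OF fin bij(1) wV[of 0]])
    fix v assume "v \<in> V"
    then obtain i where i: "i < p" "v = w i" using ex by blast
    then show "\<exists>e. (F ^^ e) v = w 0" using pow[OF i(1), of "p - i"] by auto
  qed
  moreover have "circulates F' V"
    using circulatesI_hub[OF fin bij(2) wV[of 0]] pow' ex by metis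
  moreover have "{y. R x y} = {F x, F' x}" if x: "x \<in> V" for x
  proof -
    obtain i where i: "i < p" "x = w i" using ex x by blast
    show ?thesis unfolding i(2) Fw[OF i(1)] by (rule nb[OF i(1)])
  qed
  moreover have "F x \<noteq> F' x" if x: "x \<in> V" for x
    using two[OF x] calculation(3)[OF x] by auto
  ultimately show ?thesis using that[of F F'] FF' F'F by blast
qed

section \<open>Toroidal grids\<close>

lemma int_two_step_induct [consumes 1, case_names parity base step]:
  fixes P :: "int \<Rightarrow> bool"
  assumes "a \<le> n" "even (n - a)" "P a" "\<And>x. a \<le> x \<Longrightarrow> x + 2 \<le> n \<Longrightarrow> even (x - a) \<Longrightarrow> P x \<Longrightarrow> P (x + 2)"
  shows "P n"
proof -
  have "P (a + 2 * int e)" if "a + 2 * int e \<le> n" for e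
    using that
  proof (induction e)
    case (Suc e)
    then show ?case using assms(4)[of "a + 2 * int e"] by (simp add: algebra_simps)
  qed (use assms in simp)
  from this[of "nat ((n - a) div 2)"] show ?thesis using assms by simp
qed

text \<open>The fibres of \<open>\<phi>\<close> are the cosets of the lattice spanned by
  \<open>(r, 0)\<close> and \<open>(- k, q)\<close>: columns are cycles of length \<open>r\<close>,
  and after \<open>q\<close> columns the grid closes with a shift by \<open>k\<close>, so that the
  rows form \<open>gcd r k\<close> classes. \<open>gq\<close> leaves room for the diagonal;
  \<open>r3\<close>, \<open>t_order\<close> and \<open>s_ne_t\<close> make the four neighbours of a
  vertex distinct.\<close>

locale torus =
  fixes \<phi> :: "int \<Rightarrow> int \<Rightarrow> 'v" and r q k :: int
  assumes q1: "q \<ge> 1" and r3: "r \<ge> 3" and gq: "gcd r k \<le> q"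
    and phi_eq: "\<And>i j i' j'. \<phi> i j = \<phi> i' j' \<longleftrightarrow> q dvd (j - j') \<and> r dvd (i - i' + k * ((j - j') div q))"
    and t_order: "\<phi> 0 2 \<noteq> \<phi> 0 0" and s_ne_t: "\<phi> 1 0 \<noteq> \<phi> 0 1" "\<phi> 1 1 \<noteq> \<phi> 0 0"
begin

definition V :: "'v set" where "V = {\<phi> i j | i j. True}"

lemma phi_in: "\<phi> i j \<in> V" unfolding V_def by blast

lemma phi_shift: "\<phi> (i + x) (j + y) = \<phi> (i' + x) (j' + y) \<longleftrightarrow> \<phi> i j = \<phi> i' j'"
  unfolding phi_eq by simp

lemma wrap: "\<phi> i (j + q) = \<phi> (i + k) j"
  unfolding phi_eq using q1 by simp

lemma same_column: "\<phi> i j = \<phi> i' j \<longleftrightarrow> r dvd (i - i')"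
  unfolding phi_eq by simp

lemma phi_eq_inside:
  assumes "0 \<le> j" "j < q" "0 \<le> j'" "j' < q"
  shows "\<phi> i j = \<phi> i' j' \<longleftrightarrow> j = j' \<and> r dvd (i - i')"
proof
  assume *: "\<phi> i j = \<phi> i' j'"
  then have "q dvd (j - j')" unfolding phi_eq by simp
  then have "j = j'" using assms by (metis mod_eq_dvd_iff mod_pos_pos_trivial)
  then show "j = j' \<and> r dvd (i - i')" using * same_column by simp
qed (simp add: phi_eq)

lemma not_dvd: "0 < x \<Longrightarrow> x < r \<Longrightarrow> \<not> r dvd x"
  using zdvd_not_zless by blast

lemma not_dvd_neg: "x < 0 \<Longrightarrow> - r < x \<Longrightarrow> \<not> r dvd x"
  using not_dvd[of "- x"] by simp

lemma coordinates:
  assumes "v \<in> V"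
  obtains i j where "0 \<le> i" "i < r" "0 \<le> j" "j < q" "v = \<phi> i j"
proof -
  obtain i j where v: "v = \<phi> i j" using assms unfolding V_def by blast
  have "j = j mod q + q * (j div q)" by simp
  then have "\<phi> i j = \<phi> ((i + k * (j div q)) mod r) (j mod q)"
    unfolding phi_eq
    by (smt (verit) dvd_minus_mod dvd_triv_left mod_eq_dvd_iff mod_mod_trivial nonzero_mult_div_cancel_left q1)
  then show ?thesis using that[of "(i + k * (j div q)) mod r" "j mod q"] v q1 r3 by simp
qed

lemma finite_V: "finite V"
proof -
  have "V \<subseteq> (\<lambda>(i, j). \<phi> i j) ` ({0..<r} \<times> {0..<q})"
    by (rule subsetI, erule coordinates) auto
  then show ?thesis by (rule finite_subset) simp
qed

text \<open>Colour the edges \<open>{\<phi> i j, \<phi> (i + 1) j}\<close> red and \<open>{\<phi> i j, \<phi> i (j + 1)}\<close> blue: there are \<open>q\<close> red cycles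
  (the columns) and \<open>g\<close> blue ones (row \<open>i\<close> belongs to the class of \<open>i\<close> modulo \<open>g\<close>). The colours are exchanged on
  the squares with lower left corner \<open>\<phi> (h j) j\<close>, \<open>0 \<le> j < N\<close>. Their heights zigzag, \<open>0, 1, 0, 1, \<dots>\<close>, in the
  first \<open>c\<close> columns, which leaves the blue connectivity unchanged, and then climb along a diagonal through the
  rows \<open>0, \<dots>, \<gamma> - 1\<close>, which links all blue classes. Taking \<open>N\<close> odd and \<open>\<gamma>\<close> even makes both colours connected
  for every parity of \<open>q\<close> and \<open>g\<close>.\<close>

definition g where "g = gcd r k"
definition \<gamma> where "\<gamma> = g + g mod 2"
definition N where "N = (if odd q then q else q - 1)"
definition c where "c = N - \<gamma> + 1"
definition h :: "int \<Rightarrow> int" where "h j = (if j < c then j mod 2 else j - c)"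

lemma g_pos: "g \<ge> 1" unfolding g_def using r3 by (simp add: int_one_le_iff_zero_less)
lemma g_dvd: "g dvd r" "g dvd k" "g \<le> r" unfolding g_def using r3 by (auto intro: zdvd_imp_le)
lemma gamma_bounds: "even \<gamma>" "2 \<le> \<gamma>" "g \<le> \<gamma>" "\<gamma> \<le> g + 1"
  unfolding \<gamma>_def using g_pos by presburger+
lemma N_bounds: "odd N" "1 \<le> N" "q - 1 \<le> N" "N \<le> q" unfolding N_def using q1 by presburger+
lemma gamma_le_N: "\<gamma> \<le> N + 1"
  unfolding \<gamma>_def N_def using gq[folded g_def] by presburger
lemma c_bounds: "even c" "0 \<le> c" "c + \<gamma> = N + 1" "c < N"
  using N_bounds gamma_bounds gamma_le_N unfolding c_def by auto

lemma h_zero: "h 0 = 0" unfolding h_def using c_bounds by simp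
lemma h_even: "even j \<Longrightarrow> j \<le> c \<Longrightarrow> h j = 0" unfolding h_def by presburger
lemma h_odd: "odd j \<Longrightarrow> j < c \<Longrightarrow> h j = 1" unfolding h_def by presburger
lemma h_diag: "0 \<le> e \<Longrightarrow> h (c + e) = e" unfolding h_def by simp

text \<open>Squares of adjacent columns at equal heights would share a red edge. At the change from
  the zigzag to the diagonal the heights differ because \<open>c\<close> is even.\<close>

lemma h_step: "\<not> r dvd (h j - h (j - 1))"
proof -
  have "h j - h (j - 1) = 1 \<or> h j - h (j - 1) = -1"
  proof (cases "j \<le> c")
    case True
    then show ?thesis using h_even[of j] h_even[of "j - 1"] h_odd[of j] h_odd[of "j - 1"] c_bounds(1)
      by (cases "even j"; cases "j = c") auto
  next
    case False
    then show ?thesis by (simp add: h_def)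
  qed
  then show ?thesis using not_dvd[of 1] not_dvd_neg[of "-1"] r3 by auto
qed

text \<open>If every column carries a square, the last one is adjacent to the first across the seam,
  where its height is shifted by \<open>k\<close>. Equal heights modulo \<open>r\<close> would force
  \<open>g\<close> to divide \<open>\<gamma> - 2 < g\<close>, hence \<open>\<gamma> = 2\<close> and
  \<open>g = r \<ge> 3\<close>, contrary to \<open>g \<le> \<gamma>\<close>.\<close>

lemma h_wrap: "N = q \<Longrightarrow> \<not> r dvd (h (q - 1) + k)"
proof
  assume Nq: "N = q" and d: "r dvd (h (q - 1) + k)"
  have "c + (\<gamma> - 2) = q - 1" using c_bounds Nq by simp
  then have h: "h (q - 1) = \<gamma> - 2" using h_diag[of "\<gamma> - 2"] gamma_bounds by (metis diff_ge_0_iff_ge)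
  have "g dvd \<gamma> - 2" using d g_dvd h by (metis dvd_add_left_iff dvd_trans)
  then have "\<gamma> = 2" using gamma_bounds
    by (smt (verit) zdvd_not_zless)
  then have "r dvd k" using d h by simp
  then have "g = r" unfolding g_def using r3 by (simp add: gcd_proj1_iff)
  then show False using \<open>\<gamma> = 2\<close> gamma_bounds r3 by linarith
qed

section \<open>Exchange squares and the two colour classes\<close>

definition in_Q :: "int \<Rightarrow> int \<Rightarrow> bool" where
  "in_Q i j \<longleftrightarrow> (\<exists>e. 0 \<le> e \<and> e < N \<and> \<phi> i j = \<phi> (h e) e)"

lemma in_Q_inside: "0 \<le> j \<Longrightarrow> j < q \<Longrightarrow> in_Q i j \<longleftrightarrow> j < N \<and> r dvd (i - h j)"
  unfolding in_Q_def using N_bounds phi_eq_inside by (smt (verit))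

lemma in_Q_before: "in_Q i (- 1) \<longleftrightarrow> N = q \<and> r dvd (i - (h (q - 1) + k))"
proof -
  have "\<phi> i (- 1) = \<phi> (i - k) (q - 1)" using wrap[of "i - k" "- 1"] by simp
  then have "in_Q i (- 1) \<longleftrightarrow> in_Q (i - k) (q - 1)" unfolding in_Q_def by simp
  then show ?thesis using in_Q_inside[of "q - 1" "i - k"] q1 N_bounds by (auto simp: algebra_simps)
qed

lemma in_Q_cong: "\<phi> i j = \<phi> i' j' \<Longrightarrow> in_Q (i + x) (j + y) = in_Q (i' + x) (j' + y)"
  unfolding in_Q_def using phi_shift by metis

lemma in_Q_excl_s: "\<not> (in_Q i j \<and> in_Q (i - 1) j)"
proof
  assume a: "in_Q i j \<and> in_Q (i - 1) j"
  then obtain e e' where e: "0 \<le> e" "e < N" "\<phi> i j = \<phi> (h e) e"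
    and e': "0 \<le> e'" "e' < N" "\<phi> (i - 1) j = \<phi> (h e') e'" unfolding in_Q_def by blast
  have "\<phi> i j = \<phi> (h e' + 1) e'" using e'(3) phi_shift[of "i - 1" 1 j 0 "h e'" e'] by simp
  then have "\<phi> (h e) e = \<phi> (h e' + 1) e'" using e by simp
  then have "e = e' \<and> r dvd (h e - (h e' + 1))" using phi_eq_inside e e' N_bounds by auto
  then show False using not_dvd[of 1] r3 by auto
qed

lemma in_Q_excl_t: "\<not> (in_Q i j \<and> in_Q i (j - 1))"
proof
  assume a: "in_Q i j \<and> in_Q i (j - 1)"
  then obtain e where e: "0 \<le> e" "e < N" "\<phi> i j = \<phi> (h e) e" unfolding in_Q_def by blast
  have "in_Q (h e) (e - 1)" using a in_Q_cong[OF e(3), of 0 "-1"] by simp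
  then show False
  proof (cases "e = 0")
    case True
    then have "N = q \<and> r dvd (h (q - 1) + k)"
      using \<open>in_Q (h e) (e - 1)\<close> in_Q_before[of 0] h_zero dvd_minus_iff[of r "h (q - 1) + k"] by simp
    then show ?thesis using h_wrap by blast
  next
    case False
    then have "r dvd (h e - h (e - 1))"
      using \<open>in_Q (h e) (e - 1)\<close> in_Q_inside[of "e - 1" "h e"] e N_bounds by simp
    then show ?thesis using h_step by blast
  qed
qed

text \<open>\<open>s\<close> stands for a step in \<open>i\<close> and \<open>t\<close> for a step
  in \<open>j\<close>. An edge changes colour if one of the two unit squares containing it is
  chosen: the one to its right or left for an \<open>s\<close>-edge, above or below for a
  \<open>t\<close>-edge.\<close>

definition flip_s where "flip_s i j \<longleftrightarrow> in_Q i j \<or> in_Q i (j - 1)"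
definition flip_t where "flip_t i j \<longleftrightarrow> in_Q i j \<or> in_Q (i - 1) j"

lemma flip_cong:
  assumes "\<phi> i j = \<phi> i' j'"
  shows "flip_s (i + x) (j + y) = flip_s (i' + x) (j' + y)"
    and "flip_t (i + x) (j + y) = flip_t (i' + x) (j' + y)"
  using in_Q_cong[OF assms, of x y] in_Q_cong[OF assms, of x "y - 1"] in_Q_cong[OF assms, of "x - 1" y]
  unfolding flip_s_def flip_t_def by (simp_all add: algebra_simps)

text \<open>\<open>R True\<close> is adjacency by red edges and \<open>R False\<close> by blue edges, after the exchange.\<close>

definition R :: "bool \<Rightarrow> 'v \<Rightarrow> 'v \<Rightarrow> bool" where
  "R b x y \<longleftrightarrow> (\<exists>i j. x = \<phi> i j \<and>
     (y = \<phi> (i + 1) j \<and> flip_s i j \<noteq> b \<or> y = \<phi> (i - 1) j \<and> flip_s (i - 1) j \<noteq> b \<or>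
      y = \<phi> i (j + 1) \<and> flip_t i j = b \<or> y = \<phi> i (j - 1) \<and> flip_t i (j - 1) = b))"

lemma R_iff:
  "R b (\<phi> i j) y \<longleftrightarrow>
     y = \<phi> (i + 1) j \<and> flip_s i j \<noteq> b \<or> y = \<phi> (i - 1) j \<and> flip_s (i - 1) j \<noteq> b \<or>
     y = \<phi> i (j + 1) \<and> flip_t i j = b \<or> y = \<phi> i (j - 1) \<and> flip_t i (j - 1) = b"
    (is "_ \<longleftrightarrow> ?P i j")
proof
  assume "R b (\<phi> i j) y"
  then obtain i' j' where eq: "\<phi> i j = \<phi> i' j'" and "?P i' j'" unfolding R_def by blast
  moreover have "\<phi> (i + 1) j = \<phi> (i' + 1) j'" "\<phi> (i - 1) j = \<phi> (i' - 1) j'"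
    "\<phi> i (j + 1) = \<phi> i' (j' + 1)" "\<phi> i (j - 1) = \<phi> i' (j' - 1)"
    using eq unfolding phi_eq by auto
  moreover have "flip_s i j = flip_s i' j'" "flip_s (i - 1) j = flip_s (i' - 1) j'"
    "flip_t i j = flip_t i' j'" "flip_t i (j - 1) = flip_t i' (j' - 1)"
    using flip_cong(1)[OF eq, of 0 0] flip_cong(1)[OF eq, of "- 1" 0]
      flip_cong(2)[OF eq, of 0 0] flip_cong(2)[OF eq, of 0 "- 1"] by simp_all
  ultimately show "?P i j" by simp
qed (use R_def in blast)

lemma R_sym: "R b x y \<Longrightarrow> R b y x"
proof -
  assume a: "R b x y"
  then obtain i j where x: "x = \<phi> i j" unfolding R_def by blast
  from a show "R b y x" unfolding x R_iff by (auto simp: R_iff)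
qed

lemma R_dom: "R b x y \<Longrightarrow> x \<in> V" unfolding R_def V_def by blast

lemma four_neighbours:
  "distinct [\<phi> (i + 1) j, \<phi> (i - 1) j, \<phi> i (j + 1), \<phi> i (j - 1)]"
proof -
  have "\<phi> (i + 1) j \<noteq> \<phi> (i - 1) j" using same_column not_dvd[of 2] r3 by simp
  moreover have "\<phi> i (j + 1) \<noteq> \<phi> i (j - 1)"
    using phi_shift[of 0 i 2 "j - 1" 0 0] t_order by (simp add: algebra_simps)
  moreover have "\<phi> (i + 1) j \<noteq> \<phi> i (j + 1)"
    using phi_shift[of 1 i 0 j 0 1] s_ne_t by (simp add: algebra_simps)
  moreover have "\<phi> (i - 1) j \<noteq> \<phi> i (j - 1)"
    using phi_shift[of 0 "i - 1" 1 "j - 1" 1 0] s_ne_t by (simp add: algebra_simps)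
  moreover have "\<phi> (i + 1) j \<noteq> \<phi> i (j - 1)"
    using phi_shift[of 1 i 1 "j - 1" 0 0] s_ne_t by (simp add: algebra_simps)
  moreover have "\<phi> (i - 1) j \<noteq> \<phi> i (j + 1)"
    using phi_shift[of 1 "i - 1" 1 j 0 0] s_ne_t by (simp add: algebra_simps)
  ultimately show ?thesis by auto
qed

lemma R_irrefl: "\<not> R b x x"
proof
  assume a: "R b x x"
  then obtain i j where x: "x = \<phi> i j" unfolding R_def by blast
  have "\<phi> i j \<noteq> \<phi> (i + 1) j" "\<phi> i j \<noteq> \<phi> (i - 1) j"
    using same_column not_dvd[of 1] r3 by auto
  moreover have "\<phi> i j \<noteq> \<phi> i (j + 1)"
  proof
    assume "\<phi> i j = \<phi> i (j + 1)"
    then have "\<phi> 0 0 = \<phi> 0 1" "\<phi> 0 1 = \<phi> 0 2"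
      using phi_shift[of 0 i 0 j 0 1] phi_shift[of 0 i 0 j 0 1] phi_shift[of 0 0 0 1 0 1]
      by (simp_all add: algebra_simps)
    then show False using t_order by simp
  qed
  moreover have "\<phi> i j \<noteq> \<phi> i (j - 1)"
  proof
    assume "\<phi> i j = \<phi> i (j - 1)"
    then have "\<phi> 0 0 = \<phi> 0 1" "\<phi> 0 1 = \<phi> 0 2"
      using phi_shift[of 0 i 1 "j - 1" 0 0] phi_shift[of 0 0 0 1 0 1]
      by (simp_all add: algebra_simps)
    then show False using t_order by simp
  qed
  ultimately show False using a unfolding x R_iff by blast
qed

text \<open>A chosen square trades one red for one blue edge at each of its corners. Of the four
  squares around a vertex at most two opposite ones are chosen, and these affect disjoint pairs of
  edges, so two edges of each colour remain.\<close>

lemma R_two: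
  assumes "x \<in> V"
  shows "card {y. R b x y} = 2"
proof -
  obtain i j where x: "x = \<phi> i j" using assms unfolding V_def by blast
  define n1 n2 n3 n4 where n: "n1 = \<phi> (i + 1) j" "n2 = \<phi> (i - 1) j" "n3 = \<phi> i (j + 1)" "n4 = \<phi> i (j - 1)"
  have d: "distinct [n1, n2, n3, n4]" unfolding n by (rule four_neighbours)
  define A B C D where abcd: "A = in_Q i j" "B = in_Q i (j - 1)" "C = in_Q (i - 1) j" "D = in_Q (i - 1) (j - 1)"
  have ex: "\<not> (A \<and> B)" "\<not> (C \<and> D)" "\<not> (A \<and> C)" "\<not> (B \<and> D)"
    unfolding abcd using in_Q_excl_s in_Q_excl_t by blast+
  have eq: "{y. R b x y} = {y. y = n1 \<and> (A \<or> B) \<noteq> b \<or> y = n2 \<and> (C \<or> D) \<noteq> b \<or>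
      y = n3 \<and> (A \<or> C) = b \<or> y = n4 \<and> (B \<or> D) = b}"
    unfolding x R_iff flip_s_def flip_t_def n abcd by simp
  have col: "{y. y = p \<or> y = p'} = {p, p'}" for p p' :: 'v by auto
  show ?thesis unfolding eq using ex d
    by (cases A; cases B; cases C; cases D; cases b; simp add: col)
qed

lemma R_split:
  "{y. R True (\<phi> i j) y} \<union> {y. R False (\<phi> i j) y} = {\<phi> (i + 1) j, \<phi> (i - 1) j, \<phi> i (j + 1), \<phi> i (j - 1)}"
  by (auto simp: R_iff)

section \<open>Walks inside one colour class\<close>

definition con where "con b i j i' j' \<longleftrightarrow> (R b)\<^sup>*\<^sup>* (\<phi> i j) (\<phi> i' j')"

lemma con_refl: "con b i j i j" unfolding con_def by simp
lemma con_sym: "con b i j i' j' \<Longrightarrow> con b i' j' i j"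
  unfolding con_def using R_sym by (metis (no_types, lifting) sympI symp_rtranclp sympD)
lemma con_trans [trans]: "con b i j i' j' \<Longrightarrow> con b i' j' i'' j'' \<Longrightarrow> con b i j i'' j''"
  unfolding con_def by simp
lemma con_eq: "\<phi> i j = \<phi> i' j' \<Longrightarrow> con b i j i' j'" unfolding con_def by simp
lemma con_period: "r dvd (i - i') \<Longrightarrow> con b i j i' j" using con_eq same_column by blast
lemma con_s: "flip_s i j \<noteq> b \<Longrightarrow> con b i j (i + 1) j"
  unfolding con_def by (rule r_into_rtranclp) (simp add: R_iff)
lemma con_t: "flip_t i j = b \<Longrightarrow> con b i j i (j + 1)"
  unfolding con_def by (rule r_into_rtranclp) (simp add: R_iff)
lemma con_wrap: "con b i q (i + k) 0"
  using con_eq wrap[of i 0] by simp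

lemma flips_at_square:
  assumes "0 \<le> j" "j < N"
  shows "flip_s (h j) j" "flip_s (h j) (j + 1)" "flip_t (h j) j" "flip_t (h j + 1) j"
  using assms in_Q_def unfolding flip_s_def flip_t_def by auto

section \<open>Connectedness of the red class\<close>

lemma con_arc:
  assumes "x0 \<le> x1" "\<And>x. x0 \<le> x \<Longrightarrow> x < x1 \<Longrightarrow> \<not> flip_s x j"
  shows "con True x0 j x1 j"
  using assms
proof (induction rule: int_ge_induct)
  case (step i)
  then show ?case using con_trans[OF step.IH con_s[of i j True]] by simp
qed (rule con_refl)

lemma dvd_in_window:
  assumes "r dvd (x - y)" "y < x" "x < y + r"
  shows False
  using assms not_dvd[of "x - y"] by simp

text \<open>Two exchanged edges, above \<open>\<alpha>\<close> and above \<open>\<beta>\<close>, cut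
  a column into an arc from \<open>\<alpha> + 1\<close> to \<open>\<beta>\<close> and an arc from
  \<open>\<beta> + 1\<close> to \<open>\<alpha>\<close>.\<close>

lemma column_two_flips:
  assumes fl: "\<And>x. flip_s x j \<Longrightarrow> r dvd (x - \<alpha>) \<or> r dvd (x - \<beta>)" and ne: "\<not> r dvd (\<beta> - \<alpha>)"
  shows "con True (\<alpha> + 1) j \<beta> j" and "con True x j \<beta> j \<or> con True x j \<alpha> j"
proof -
  \<comment> \<open>The copy of \<open>\<beta>\<close> between \<open>\<alpha>\<close> and
    \<open>\<alpha> + r\<close>, so that the arcs become integer intervals.\<close>
  define \<beta>' where "\<beta>' = \<alpha> + (\<beta> - \<alpha>) mod r"
  have "\<beta>' - \<beta> = - ((\<beta> - \<alpha>) - (\<beta> - \<alpha>) mod r)" unfolding \<beta>'_def by linarith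
  then have b: "r dvd (\<beta>' - \<beta>)" by (metis dvd_minus_iff dvd_minus_mod)
  have "(\<beta> - \<alpha>) mod r \<noteq> 0" using ne by (simp add: dvd_eq_mod_eq_0)
  then have bb: "\<alpha> < \<beta>'" "\<beta>' < \<alpha> + r" unfolding \<beta>'_def using r3
    by (smt (verit) pos_mod_bound pos_mod_sign)+
  have fl': "r dvd (x - \<alpha>) \<or> r dvd (x - \<beta>')" if "flip_s x j" for x
    using fl[OF that] dvd_diff[of r "x - \<beta>" "\<beta>' - \<beta>"] b by auto
  have "\<not> flip_s x j" if "\<alpha> + 1 \<le> x" "x < \<beta>'" for x
    using fl'[of x] that bb dvd_in_window[of x \<alpha>] dvd_in_window[of \<beta>' x] by (auto simp: dvd_diff_commute)
  then have arc1: "con True x j \<beta>' j" if "\<alpha> + 1 \<le> x" "x \<le> \<beta>'" for x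
    using con_arc[of x \<beta>'] that by simp
  have "\<not> flip_s x j" if "\<beta>' < x" "x < \<alpha> + r" for x
    using fl'[of x] that bb dvd_in_window[of x \<alpha>] dvd_in_window[of x \<beta>'] by auto
  then have arc2: "con True x j (\<alpha> + r) j" if "\<beta>' < x" "x \<le> \<alpha> + r" for x
    using con_arc[of x "\<alpha> + r"] that by simp
  have to\<beta>: "con True \<beta>' j \<beta> j" using con_period b by blast
  have to\<alpha>: "con True (\<alpha> + r) j \<alpha> j" using con_period by simp
  show "con True (\<alpha> + 1) j \<beta> j" using con_trans[OF arc1 to\<beta>] bb by simp
  define x' where "x' = \<alpha> + 1 + (x - \<alpha> - 1) mod r"
  have x: "\<alpha> + 1 \<le> x'" "x' \<le> \<alpha> + r" unfolding x'_def using r3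
    by (smt (verit) pos_mod_bound pos_mod_sign)+
  have "x - x' = (x - \<alpha> - 1) - (x - \<alpha> - 1) mod r" unfolding x'_def by linarith
  then have "r dvd (x - x')" by (metis dvd_minus_mod)
  then have xx: "con True x j x' j" using con_period by blast
  show "con True x j \<beta> j \<or> con True x j \<alpha> j"
    using x con_trans[OF xx con_trans[OF arc1 to\<beta>]] con_trans[OF xx con_trans[OF arc2 to\<alpha>]]
    by (cases "x' \<le> \<beta>'") auto
qed

lemma column_one_flip:
  assumes fl: "\<And>x. flip_s x j \<Longrightarrow> r dvd (x - \<alpha>)"
  shows "con True x j \<alpha> j"
proof -
  define x' where "x' = \<alpha> + 1 + (x - \<alpha> - 1) mod r"
  have x: "\<alpha> + 1 \<le> x'" "x' \<le> \<alpha> + r" unfolding x'_def using r3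
    by (smt (verit) pos_mod_bound pos_mod_sign)+
  have "x - x' = (x - \<alpha> - 1) - (x - \<alpha> - 1) mod r" unfolding x'_def by linarith
  then have "r dvd (x - x')" by (metis dvd_minus_mod)
  then have "con True x j x' j" using con_period by blast
  also have "con True x' j (\<alpha> + r) j"
  proof (rule con_arc)
    fix y assume "x' \<le> y" "y < \<alpha> + r"
    then show "\<not> flip_s y j" using fl[of y] dvd_in_window[of y \<alpha>] x by auto
  qed (use x in simp)
  also have "con True (\<alpha> + r) j \<alpha> j" using con_period by simp
  finally show ?thesis .
qed

lemma flip_s_inside:
  assumes "1 \<le> j" "j < q"
  shows "flip_s x j \<longleftrightarrow> j < N \<and> r dvd (x - h j) \<or> r dvd (x - h (j - 1))"
  unfolding flip_s_def using in_Q_inside[of j x] in_Q_inside[of "j - 1" x] assms N_bounds by auto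

lemma flip_s_first:
  "flip_s x 0 \<longleftrightarrow> r dvd (x - h 0) \<or> N = q \<and> r dvd (x - (h (q - 1) + k))"
  unfolding flip_s_def using in_Q_inside[of 0 x] in_Q_before[of x] q1 N_bounds by auto

lemma red_square:
  assumes "0 \<le> j" "j < N"
  shows "con True (h j) (j + 1) (h j) j" "con True (h j + 1) (j + 1) (h j + 1) j"
  using flips_at_square(3,4)[OF assms] con_sym[OF con_t[of _ _ True]] by simp_all

text \<open>The arc ending at \<open>h j\<close> starts at \<open>h (j - 1) + 1\<close>, an upper
  corner of the previous square. So crossing a column interchanges lower and upper corners, which is
  the source of the parity condition on \<open>N\<close>.\<close>

lemma red_column:
  assumes j: "1 \<le> j" "j < N"
  shows "con True (h j) j (h (j - 1) + 1) (j - 1)" and "con True (h j + 1) j (h (j - 1)) (j - 1)"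
    and "con True x j (h j) j \<or> con True x j (h (j - 1)) (j - 1)"
proof -
  have jq: "j < q" using j N_bounds by simp
  have fl: "r dvd (x - h (j - 1)) \<or> r dvd (x - h j)" if "flip_s x j" for x
    using flip_s_inside[OF j(1) jq] that by blast
  then have fl': "r dvd (x - h j) \<or> r dvd (x - h (j - 1))" if "flip_s x j" for x
    using that by blast
  have ne: "\<not> r dvd (h j - h (j - 1))" "\<not> r dvd (h (j - 1) - h j)"
    using h_step dvd_diff_commute by blast+
  note t1 = column_two_flips[of j "h (j - 1)" "h j", OF fl ne(1)]
  note t2 = column_two_flips[of j "h j" "h (j - 1)", OF fl' ne(2)]
  have sq: "con True (h (j - 1)) j (h (j - 1)) (j - 1)" "con True (h (j - 1) + 1) j (h (j - 1) + 1) (j - 1)"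
    using red_square[of "j - 1"] j by simp_all
  show "con True (h j) j (h (j - 1) + 1) (j - 1)"
    using con_trans[OF con_sym[OF t1(1)] sq(2)] by simp
  show "con True (h j + 1) j (h (j - 1)) (j - 1)"
    using con_trans[OF t2(1) sq(1)] by simp
  show "con True x j (h j) j \<or> con True x j (h (j - 1)) (j - 1)"
    using t1(2)[of x] con_trans[of True x j "h (j - 1)" j, OF _ sq(1)] by metis
qed

text \<open>The two arcs of each column alternate along the columns; for \<open>N = q\<close>, which is then odd, going once around
  exchanges them, so that they are connected.\<close>

lemma red_alternating:
  assumes "0 \<le> j" "j < N"
  shows "if even j then con True (h j) j (h 0) 0 \<and> con True (h j + 1) j (h 0 + 1) 0
    else con True (h j) j (h 0 + 1) 0 \<and> con True (h j + 1) j (h 0) 0"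
  using assms
proof (induction rule: int_ge_induct)
  case base
  then show ?case by (simp add: con_refl)
next
  case (step j)
  have a: "con True (h (j + 1)) (j + 1) (h j + 1) j" and b: "con True (h (j + 1) + 1) (j + 1) (h j) j"
    using red_column(1,2)[of "j + 1"] step.hyps step.prems by simp_all
  show ?case using step.IH step.prems con_trans[OF a] con_trans[OF b] by (cases "even j") auto
qed

lemma red_start: "con True (h 0 + 1) 0 (h 0) 0"
proof (cases "N = q")
  case True
  have fl: "r dvd (x - h 0) \<or> r dvd (x - (h (q - 1) + k))" if "flip_s x 0" for x
    using flip_s_first[of x] that by blast
  have "con True (h 0 + 1) 0 (h (q - 1) + k) 0"
    by (rule column_two_flips(1)[OF fl]) (use h_wrap True h_zero in auto)
  also have "con True (h (q - 1) + k) 0 (h (q - 1)) q" using con_sym con_wrap by blast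
  also have "con True (h (q - 1)) q (h (q - 1)) (q - 1)"
    using red_square(1)[of "q - 1"] True q1 by simp
  \<comment> \<open>\<open>q - 1 = N - 1\<close> is even, so the lower corner is reached; an odd
    index would lead back to \<open>h 0 + 1\<close>, where the walk began.\<close>
  also have "con True (h (q - 1)) (q - 1) (h 0) 0"
    using red_alternating[of "q - 1"] True q1 N_bounds by auto
  finally show ?thesis .
next
  case False
  then show ?thesis using column_one_flip[of 0 "h 0"] flip_s_first by blast
qed

lemma red_hubs:
  assumes "0 \<le> j" "j < N"
  shows "con True (h j) j (h 0) 0"
  using red_alternating[OF assms] con_trans[OF _ red_start] by (cases "even j") auto

lemma red_connected:
  assumes j: "0 \<le> j" "j < q"
  shows "con True x j (h 0) 0"
proof -
  \<comment> \<open>The last case is the column without a square of its own, present for even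
    \<open>q\<close> and cut only once.\<close>
  consider "j = 0" "N = q" | "j = 0" "N \<noteq> q" | "1 \<le> j" "j < N" | "1 \<le> j" "j = N" "j = q - 1"
    using j N_bounds by linarith
  then show ?thesis
  proof cases
    case 1
    have fl: "r dvd (x - (h (q - 1) + k)) \<or> r dvd (x - h 0)" if "flip_s x 0" for x
      using flip_s_first[of x] that by blast
    have "\<not> r dvd (h 0 - (h (q - 1) + k))" using h_wrap 1 h_zero
      by (metis diff_0 dvd_minus_iff)
    from column_two_flips(2)[of 0 "h (q - 1) + k" "h 0", OF fl this]
    have "con True x 0 (h 0) 0 \<or> con True x 0 (h (q - 1) + k) 0" by blast
    moreover have "con True (h (q - 1) + k) 0 (h 0) 0"
    proof -
      have "con True (h (q - 1) + k) 0 (h (q - 1)) q" by (rule con_sym[OF con_wrap])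
      also have "con True (h (q - 1)) q (h (q - 1)) (q - 1)" using red_square(1)[of "q - 1"] 1 q1 by simp
      also have "con True (h (q - 1)) (q - 1) (h 0) 0" using red_hubs[of "q - 1"] 1 q1 by simp
      finally show ?thesis .
    qed
    ultimately show ?thesis using 1 con_trans[of True x 0 "h (q - 1) + k" 0 "h 0" 0] by blast
  next
    case 2
    then show ?thesis using column_one_flip[of 0 "h 0"] flip_s_first by blast
  next
    case 3
    have "con True (h j) j (h 0) 0" "con True (h (j - 1)) (j - 1) (h 0) 0" using red_hubs 3 by simp_all
    then show ?thesis using red_column(3)[OF 3, of x] con_trans by metis
  next
    case 4
    have "con True x j (h (j - 1)) j"
      by (rule column_one_flip) (use flip_s_inside[of j] 4 in auto)
    also have "con True (h (j - 1)) j (h (j - 1)) (j - 1)"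
      using red_square(1)[of "j - 1"] 4 by simp
    also have "con True (h (j - 1)) (j - 1) (h 0) 0" using red_hubs[of "j - 1"] 4 by simp
    finally show ?thesis .
  qed
qed

section \<open>Connectedness of the blue class\<close>

lemma blue_row:
  assumes "j0 \<le> j1" "0 \<le> j0" "j1 \<le> q"
    and "\<And>j. j0 \<le> j \<Longrightarrow> j < j1 \<Longrightarrow> j < N \<Longrightarrow> \<not> r dvd (i - h j) \<and> \<not> r dvd (i - 1 - h j)"
  shows "con False i j0 i j1"
  using assms(1,3,4)
proof (induction rule: int_ge_induct)
  case (step j)
  have "\<not> flip_t i j" unfolding flip_t_def
    using in_Q_inside[of j i] in_Q_inside[of j "i - 1"] step.hyps step.prems assms(2) by auto
  then have "con False i j i (j + 1)" using con_t[of i j False] by simp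
  then show ?case using con_trans[OF step.IH] step.prems by auto
qed (rule con_refl)

lemma blue_square:
  assumes "0 \<le> j" "j < N"
  shows "con False (h j) j (h j + 1) j" "con False (h j) (j + 1) (h j + 1) (j + 1)"
  using flips_at_square(1,2)[OF assms] con_s[of _ _ False] by simp_all

text \<open>Row 2 makes a detour: in column \<open>j + 1\<close> down to row 0, along row 0 to
  column \<open>j + 2\<close>, and up again. It collects vertices of rows 0 and 1 on the way and
  then continues like an undisturbed row.\<close>

lemma blue_zigzag_step:
  assumes j: "even j" "0 \<le> j" "j + 2 \<le> c" and start: "con False 2 0 2 j"
  shows "con False 2 0 2 (j + 1)" "con False 2 0 1 (j + 1)" "con False 2 0 0 (j + 1)"
    "con False 2 0 0 (j + 2)" "con False 2 0 1 (j + 2)" "con False 2 0 2 (j + 2)"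
proof -
  have hj: "h j = 0" "h (j + 1) = 1" "h (j + 2) = 0"
    using h_even h_odd j by auto
  have jN: "j + 2 < N" using c_bounds j by simp
  have nd: "\<not> r dvd 2" "\<not> r dvd 1" "\<not> r dvd - 1" "\<not> r dvd - 2" using r3 not_dvd[of 2] not_dvd[of 1] by auto
  have "con False 2 j 2 (j + 1)"
    by (rule blue_row) (use j hj nd N_bounds jN in \<open>auto simp: order.antisym\<close>)
  with start show 1: "con False 2 0 2 (j + 1)" by (rule con_trans)
  have "con False 2 (j + 1) 1 (j + 1)" using con_sym blue_square(1)[of "j + 1"] hj j jN by simp
  with 1 show 2: "con False 2 0 1 (j + 1)" by (rule con_trans)
  have "con False 1 (j + 1) 0 (j + 1)" using con_sym blue_square(2)[of j] hj j jN by simp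
  with 2 show 3: "con False 2 0 0 (j + 1)" by (rule con_trans)
  have "con False 0 (j + 1) 0 (j + 1 + 1)"
  proof (rule blue_row)
    fix e assume "j + 1 \<le> e" "e < j + 1 + 1"
    then have "e = j + 1" by simp
    then show "\<not> r dvd (0 - h e) \<and> \<not> r dvd (0 - 1 - h e)" using hj nd by simp
  qed (use j N_bounds jN in auto)
  then have "con False 0 (j + 1) 0 (j + 2)" by (simp add: add.assoc)
  with 3 show 4: "con False 2 0 0 (j + 2)" by (rule con_trans)
  have "con False 0 (j + 2) 1 (j + 2)" using blue_square(1)[of "j + 2"] hj j jN by simp
  with 4 show 5: "con False 2 0 1 (j + 2)" by (rule con_trans)
  have "con False 1 (j + 2) 2 (j + 2)" using blue_square(2)[of "j + 1"] hj j jN by (simp add: add.assoc)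
  with 5 show "con False 2 0 2 (j + 2)" by (rule con_trans)
qed

lemma blue_zigzag_even: "2 * int e \<le> c \<Longrightarrow> con False 2 0 2 (2 * int e)"
proof (induction e)
  case (Suc e)
  then show ?case using blue_zigzag_step(6)[of "2 * int e"] by (simp add: algebra_simps)
qed (simp add: con_refl)

lemma blue_zigzag:
  assumes "0 \<le> j" "j \<le> c"
  shows "con False 2 0 2 j" and "1 \<le> j \<Longrightarrow> con False 2 0 1 j" and "1 \<le> j \<Longrightarrow> con False 2 0 0 j"
proof -
  have ev: "con False 2 0 2 j" if "even j" "0 \<le> j" "j \<le> c" for j
    using blue_zigzag_even[of "nat (j div 2)"] that by simp
  have all: "con False 2 0 2 j \<and> con False 2 0 1 j \<and> con False 2 0 0 j" if "1 \<le> j"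
  proof (cases "even j")
    case True
    then have "2 \<le> j" using that by presburger
    then show ?thesis using blue_zigzag_step(4-6)[of "j - 2"] ev[of "j - 2"] True assms by simp
  next
    case False
    then have "j \<noteq> c" using c_bounds by blast
    then have "j + 1 \<le> c" using assms by simp
    then show ?thesis using blue_zigzag_step(1-3)[of "j - 1"] ev[of "j - 1"] False that by simp
  qed
  show "con False 2 0 2 j" using all assms by (cases "j = 0") (auto simp: con_refl)
  show "1 \<le> j \<Longrightarrow> con False 2 0 1 j" "1 \<le> j \<Longrightarrow> con False 2 0 0 j" using all by auto
qed

text \<open>Rows 0 and 1 are turned back by the first square. Row 2 gets through by its detours, and
  the other rows meet no square here.\<close>

lemma blue_left_row:
  assumes j: "0 \<le> j" "j \<le> c" and i: "\<not> r dvd i" "\<not> r dvd (i - 1)"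
  shows "con False i 0 i j"
proof (cases "r dvd (i - 2)")
  case True
  have "con False i 0 2 0" using con_period True by blast
  also have "con False 2 0 2 j" using blue_zigzag j by blast
  also have "con False 2 j i j" using con_sym con_period True by blast
  finally show ?thesis .
next
  case False
  show ?thesis
  proof (rule blue_row)
    fix e assume "0 \<le> e" "e < j"
    then have "h e = 0 \<or> h e = 1" using h_even h_odd j by (cases "even e") auto
    then show "\<not> r dvd (i - h e) \<and> \<not> r dvd (i - 1 - h e)" using False i by auto
  qed (use j c_bounds N_bounds in auto)
qed

lemma blue_left:
  assumes j: "0 \<le> j" "j \<le> c"
  shows "\<exists>i'. con False i j i' 0"
proof (cases "r dvd i \<or> r dvd (i - 1)")
  case True
  show ?thesis
  proof (cases "j = 0")
    case False
    then have "con False 2 0 1 j" "con False 2 0 0 j" using blue_zigzag j by auto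
    moreover have "con False i j 0 j \<or> con False i j 1 j" using True con_period[of i 0] con_period[of i 1] by auto
    ultimately show ?thesis using con_trans[OF _ con_sym] by metis
  qed (use con_refl in blast)
next
  case False
  then show ?thesis using con_sym[OF blue_left_row[OF j]] by metis
qed

lemma blue_start: "con False 1 0 0 0"
  using con_sym blue_square(1)[of 0] h_zero N_bounds by simp

text \<open>From the left, row \<open>\<rho>\<close> is free until it becomes the top of the
  diagonal square in column \<open>c + \<rho> - 1\<close>.\<close>

lemma blue_row_left:
  assumes "2 \<le> \<rho>" "\<rho> \<le> \<gamma> - 1" "\<rho> < r" "c \<le> j" "j \<le> c + \<rho> - 1"
  shows "con False \<rho> 0 \<rho> j"
proof -
  have "con False \<rho> 0 \<rho> c"
    using blue_left_row[of c \<rho>] not_dvd[of \<rho>] not_dvd[of "\<rho> - 1"] c_bounds assms by simp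
  also have "con False \<rho> c \<rho> j"
  proof (rule blue_row)
    fix e assume e: "c \<le> e" "e < j"
    then have "h e = e - c" using h_diag[of "e - c"] by simp
    then show "\<not> r dvd (\<rho> - h e) \<and> \<not> r dvd (\<rho> - 1 - h e)"
      using not_dvd[of "\<rho> - (e - c)"] not_dvd[of "\<rho> - 1 - (e - c)"] e assms by simp
  qed (use assms c_bounds N_bounds in auto)
  finally show ?thesis .
qed

text \<open>From column \<open>c + \<rho> + 1\<close> on, all squares lie above row
  \<open>\<rho>\<close>. The last condition sets aside row 0 when \<open>\<gamma> - 1 = r\<close>,
  since it is then also the top row of the last square.\<close>

lemma blue_row_right:
  assumes "0 \<le> \<rho>" "c + \<rho> + 1 \<le> j" "j \<le> q" "1 \<le> \<rho> \<or> \<gamma> - 1 < r"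
  shows "con False \<rho> j (\<rho> + k) 0"
proof -
  have "\<gamma> - 1 \<le> r" using gamma_bounds g_dvd by simp
  have "con False \<rho> j \<rho> q"
  proof (rule blue_row)
    fix e assume e: "j \<le> e" "e < q" "e < N"
    then have "h e = e - c" using h_diag[of "e - c"] assms by simp
    moreover have "e - c \<le> \<gamma> - 2" using e c_bounds by simp
    ultimately show "\<not> r dvd (\<rho> - h e) \<and> \<not> r dvd (\<rho> - 1 - h e)"
      using not_dvd_neg[of "\<rho> - (e - c)"] not_dvd_neg[of "\<rho> - 1 - (e - c)"] e assms \<open>\<gamma> - 1 \<le> r\<close> by auto
  qed (use assms c_bounds N_bounds in auto)
  also have "con False \<rho> q (\<rho> + k) 0" by (rule con_wrap)
  finally show ?thesis .
qed

lemma blue_plain_row: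
  assumes i: "\<And>\<rho>. 0 \<le> \<rho> \<Longrightarrow> \<rho> \<le> \<gamma> - 1 \<Longrightarrow> \<not> r dvd (i - \<rho>)" and j: "c \<le> j" "j \<le> q"
  shows "con False i 0 i j"
proof -
  have "con False i 0 i c" using blue_left_row[of c i] i[of 0] i[of 1] c_bounds gamma_bounds by simp
  also have "con False i c i j"
  proof (rule blue_row)
    fix e assume e: "c \<le> e" "e < N"
    then have "h e = e - c" using h_diag[of "e - c"] by simp
    then show "\<not> r dvd (i - h e) \<and> \<not> r dvd (i - 1 - h e)"
      using i[of "e - c"] i[of "e - c + 1"] e c_bounds by (simp add: diff_diff_eq add.commute)
  qed (use j c_bounds in auto)
  finally show ?thesis .
qed

lemma blue_diag_low:
  assumes "1 \<le> \<rho>" "\<rho> \<le> \<gamma> - 2" "\<rho> + 1 < r"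
  shows "con False \<rho> (c + \<rho>) (\<rho> + 1) 0"
proof -
  have "con False \<rho> (c + \<rho>) (\<rho> + 1) (c + \<rho>)"
    using blue_square(1)[of "c + \<rho>"] h_diag[of \<rho>] assms c_bounds by simp
  also have "con False (\<rho> + 1) (c + \<rho>) (\<rho> + 1) 0"
    using con_sym[OF blue_row_left[of "\<rho> + 1" "c + \<rho>"]] assms by simp
  finally show ?thesis .
qed

lemma blue_diag_high:
  assumes "0 \<le> \<rho>" "\<rho> \<le> \<gamma> - 2" "1 \<le> \<rho> \<or> \<gamma> - 1 < r"
  shows "con False (\<rho> + 1) (c + \<rho> + 1) (\<rho> + k) 0"
proof -
  have "con False (\<rho> + 1) (c + \<rho> + 1) \<rho> (c + \<rho> + 1)"
    using con_sym[OF blue_square(2)[of "c + \<rho>"]] h_diag[of \<rho>] assms c_bounds by simp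
  also have "con False \<rho> (c + \<rho> + 1) (\<rho> + k) 0"
    using blue_row_right[of \<rho> "c + \<rho> + 1"] assms c_bounds N_bounds by simp
  finally show ?thesis .
qed

text \<open>The vertex \<open>(\<rho> + 1, c + \<rho> + 1)\<close> has only vertical blue edges.
  Upwards it is linked to row \<open>\<rho> + 2\<close> on the left, downwards to row
  \<open>\<rho>\<close> on the right: passing the diagonal lowers a strand by two rows.\<close>

lemma blue_diag_skip:
  assumes "0 \<le> \<rho>" "\<rho> \<le> \<gamma> - 3" "\<rho> + 2 < r" "1 \<le> \<rho> \<or> \<gamma> - 1 < r"
  shows "con False (\<rho> + 2) 0 (\<rho> + k) 0"
proof -
  have "con False (\<rho> + 2) 0 (\<rho> + 1) (c + \<rho> + 1)"
    using con_sym[OF blue_diag_low[of "\<rho> + 1"]] assms by (simp add: add.assoc)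
  also have "con False (\<rho> + 1) (c + \<rho> + 1) (\<rho> + k) 0"
    using blue_diag_high[of \<rho>] assms by simp
  finally show ?thesis .
qed

lemma reach_by_k:
  assumes "g dvd (i - \<rho>)"
  shows "\<exists>m::nat. r dvd (i + int m * k - \<rho>)"
proof -
  obtain z where z: "i - \<rho> = g * z" using assms by blast
  obtain x y where xy: "x * r + y * k = g" unfolding g_def using bezout_int[of r k] by blast
  \<comment> \<open>By Bezout \<open>- z * y\<close> is a solution; its residue modulo
    \<open>r\<close> is taken because the walk around the torus only goes forward.\<close>
  define m where "m = nat ((- z * y) mod r)"
  have "(- z * y) mod r \<ge> 0" using r3 by simp
  then have m: "int m = (- z * y) mod r" unfolding m_def by simp
  have "r dvd (int m - (- z * y))" unfolding m by (metis dvd_diff_commute dvd_minus_mod)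
  then have "r dvd (int m - (- z * y)) * k + r * (x * z)" by simp
  moreover have "(int m - (- z * y)) * k + r * (x * z) = int m * k + (x * r + y * k) * z"
    by (simp add: algebra_simps)
  ultimately have "r dvd (int m * k + g * z)" using xy by simp
  then show ?thesis unfolding z[symmetric] by (metis add.commute add_diff_eq)
qed

text \<open>Follow row \<open>i\<close> around the torus until it first meets one of the rows of the diagonal.\<close>

lemma blue_walk:
  "\<exists>\<rho>. 0 \<le> \<rho> \<and> \<rho> \<le> \<gamma> - 1 \<and> g dvd (i - \<rho>) \<and> con False i 0 \<rho> 0"
proof -
  define P where "P m \<longleftrightarrow> (\<exists>\<rho>. 0 \<le> \<rho> \<and> \<rho> \<le> \<gamma> - 1 \<and> r dvd (i + int m * k - \<rho>))" for m
  have "g dvd (i - i mod g)" by (rule dvd_minus_mod)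
  then obtain m0 where "r dvd (i + int m0 * k - i mod g)" using reach_by_k by blast
  moreover have "0 \<le> i mod g" "i mod g \<le> \<gamma> - 1"
    using g_pos gamma_bounds(3) pos_mod_sign[of g i] pos_mod_bound[of g i] by linarith+
  ultimately have "P m0" unfolding P_def by blast
  then obtain m where m: "P m" "\<And>m'. m' < m \<Longrightarrow> \<not> P m'" using exists_least_iff[of P] by blast
  have walk: "con False i 0 (i + int m' * k) 0" if "m' \<le> m" for m'
    using that
  proof (induction m')
    case (Suc m')
    have np: "\<not> P m'" using m Suc.prems by simp
    have "con False (i + int m' * k) 0 (i + int m' * k) q"
      by (rule blue_plain_row) (use np P_def c_bounds N_bounds in auto)
    also have "con False (i + int m' * k) q (i + int m' * k + k) 0" by (rule con_wrap)
    finally have "con False i 0 (i + int m' * k + k) 0" using con_trans[OF Suc.IH] Suc.prems by simp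
    then show ?case by (simp add: algebra_simps)
  qed (simp add: con_refl)
  obtain \<rho> where \<rho>: "0 \<le> \<rho>" "\<rho> \<le> \<gamma> - 1" "r dvd (i + int m * k - \<rho>)" using m unfolding P_def by blast
  have "g dvd (i + int m * k - \<rho>)" using \<rho> g_dvd dvd_trans by blast
  then have "g dvd (i + int m * k - \<rho> - int m * k)" using g_dvd by (simp only: dvd_diff dvd_mult)
  then have "g dvd (i - \<rho>)" by (simp add: algebra_simps)
  moreover have "con False i 0 \<rho> 0" using con_trans[OF walk[of m] con_period[OF \<rho>(3)]] by simp
  ultimately show ?thesis using \<rho> by blast
qed

text \<open>Passing the diagonal lowers the row by two and shifts it by \<open>k\<close>, and
  \<open>blue_walk\<close> undoes the shift. So rows of equal parity are linked, down to rows 1 and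
  0, which the first square joins.\<close>

lemma blue_hubs_generic:
  assumes nd: "\<gamma> - 1 < r"
  shows "con False i 0 0 0"
proof -
  \<comment> \<open>The walk stays in its class modulo \<open>g\<close>, and among
    \<open>0, ..., \<gamma> - 1\<close> only \<open>0\<close> and \<open>\<gamma> - 1\<close> can be
    congruent; hence the rows considered here come back to themselves.\<close>
  have ret: "con False (\<rho> + k) 0 \<rho> 0" if \<rho>: "1 \<le> \<rho>" "\<rho> \<le> \<gamma> - 3" for \<rho>
  proof -
    obtain \<rho>' where \<rho>': "0 \<le> \<rho>'" "\<rho>' \<le> \<gamma> - 1" "g dvd (\<rho> + k - \<rho>')" "con False (\<rho> + k) 0 \<rho>' 0"
      using blue_walk by blast
    have "g dvd (\<rho> + k - \<rho>' - k)" using \<rho>'(3) g_dvd by (simp only: dvd_diff)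
    then have d: "g dvd (\<rho> - \<rho>')" by (simp add: algebra_simps)
    have "\<bar>\<rho> - \<rho>'\<bar> < g" using \<rho> \<rho>' gamma_bounds by linarith
    then have "\<rho> - \<rho>' = 0" using d g_pos dvd_imp_le_int[of "\<rho> - \<rho>'" g] by linarith
    then show ?thesis using \<rho>' by simp
  qed
  have skip: "con False (\<rho> + 2) 0 \<rho> 0" if "1 \<le> \<rho>" "\<rho> \<le> \<gamma> - 3" for \<rho>
    by (rule con_trans[OF blue_diag_skip ret]) (use that nd in auto)
  have odd: "con False \<rho> 0 0 0" if "odd \<rho>" "1 \<le> \<rho>" "\<rho> \<le> \<gamma> - 1" for \<rho>
    using that(2)
  proof (induction rule: int_two_step_induct)
    case (step x)
    then show ?case using con_trans[OF skip] that(3) by simp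
  qed (use that blue_start in auto)
  \<comment> \<open>The class of row 0 may be met at row \<open>\<gamma> - 1\<close> instead. That
    row is odd, since \<open>\<gamma>\<close> is even, and therefore already linked.\<close>
  have k0: "con False k 0 0 0"
  proof -
    obtain \<rho> where \<rho>: "0 \<le> \<rho>" "\<rho> \<le> \<gamma> - 1" "g dvd (k - \<rho>)" "con False k 0 \<rho> 0"
      using blue_walk by blast
    show ?thesis
    proof (cases "\<rho> = 0")
      case False
      have "g dvd (k - (k - \<rho>))" using \<rho>(3) g_dvd by (simp only: dvd_diff)
      then have "g \<le> \<rho>" using zdvd_imp_le[of g \<rho>] \<rho> False by simp
      then have "\<rho> = \<gamma> - 1" using \<rho> gamma_bounds by simp
      then have "con False \<rho> 0 0 0" using odd[of \<rho>] gamma_bounds by simp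
      with \<rho>(4) show ?thesis by (rule con_trans)
    qed (use \<rho> in simp)
  qed
  have even: "con False \<rho> 0 0 0" if "even \<rho>" "0 \<le> \<rho>" "\<rho> \<le> \<gamma> - 1" for \<rho>
    using that(2)
  proof (induction rule: int_two_step_induct)
    case (step x)
    show ?case
    proof (cases "x = 0")
      case True
      then show ?thesis using con_trans[OF blue_diag_skip[of 0]] k0 step that(3) nd by simp
    next
      case False
      then show ?thesis using con_trans[OF skip] step that(3) by simp
    qed
  qed (use that con_refl in auto)
  obtain \<rho> where \<rho>: "0 \<le> \<rho>" "\<rho> \<le> \<gamma> - 1" "con False i 0 \<rho> 0"
    using blue_walk by blast
  have "con False \<rho> 0 0 0"
  proof (cases "even \<rho>")
    case False
    then have "1 \<le> \<rho>" using \<rho> by presburger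
    then show ?thesis using odd False \<rho> by blast
  qed (use even \<rho> in blast)
  with \<rho>(3) show ?thesis by (rule con_trans)
qed

text \<open>When \<open>r\<close> is odd and divides \<open>k\<close>, the top row of the last square is row \<open>0\<close> again.\<close>

lemma blue_hubs_degenerate:
  assumes dg: "\<not> \<gamma> - 1 < r"
  shows "con False i 0 0 0" and "con False 1 (c + 1) 0 0"
proof -
  have gm: "\<gamma> = r + 1" "g = r" using dg gamma_bounds g_dvd by simp_all
  have ro: "odd r" using gamma_bounds(1) gm by simp
  have rk: "r dvd k" using g_dvd gm by simp
  have drop: "con False (\<rho> + k) 0 \<rho> 0" for \<rho> using con_period rk by simp
  have skip: "con False (\<rho> + 2) 0 \<rho> 0" if "1 \<le> \<rho>" "\<rho> \<le> r - 3" for \<rho>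
    by (rule con_trans[OF blue_diag_skip drop]) (use that gm in auto)
  have odd: "con False \<rho> 0 0 0" if "odd \<rho>" "1 \<le> \<rho>" "\<rho> \<le> r - 1" for \<rho>
    using that(2)
  proof (induction rule: int_two_step_induct)
    case (step x)
    then show ?case using con_trans[OF skip] that(3) by simp
  qed (use that blue_start in auto)
  \<comment> \<open>Followed to the right, row 0 arrives as row \<open>r\<close> at the upper left
    corner of the last square and descends from there to the odd row \<open>r - 2\<close>.\<close>
  have "con False 1 (c + 1) 0 (c + 1)"
    using con_sym[OF blue_square(2)[of c]] h_diag[of 0] c_bounds by simp
  also have "con False 0 (c + 1) 0 (c + (r - 1))"
  proof (rule blue_row)
    fix e assume e: "c + 1 \<le> e" "e < c + (r - 1)"
    then have "h e = e - c" using h_diag[of "e - c"] by simp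
    then show "\<not> r dvd (0 - h e) \<and> \<not> r dvd (0 - 1 - h e)"
      using not_dvd_neg[of "0 - (e - c)"] not_dvd_neg[of "0 - 1 - (e - c)"] e by simp
  qed (use c_bounds N_bounds gm r3 in auto)
  also have "con False 0 (c + (r - 1)) r (c + (r - 1))" using con_period by simp
  also have "con False r (c + (r - 1)) (r - 1) (c + (r - 1))"
    using con_sym[OF blue_square(1)[of "c + (r - 1)"]] h_diag[of "r - 1"] c_bounds r3 gm by simp
  also have "con False (r - 1) (c + (r - 1)) (r - 2 + k) 0"
    using blue_diag_high[of "r - 2"] r3 gm by (simp add: algebra_simps)
  also have "con False (r - 2 + k) 0 (r - 2) 0" by (rule drop)
  also have "con False (r - 2) 0 0 0" using odd[of "r - 2"] ro r3 by simp
  finally show y1: "con False 1 (c + 1) 0 0" .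
  have two: "con False 2 0 0 0"
    using con_trans[OF con_sym[OF blue_diag_low[of 1]] y1] gm r3 by simp
  have even: "con False \<rho> 0 0 0" if "even \<rho>" "2 \<le> \<rho>" "\<rho> \<le> r - 1" for \<rho>
    using that(2)
  proof (induction rule: int_two_step_induct)
    case (step x)
    then show ?case using con_trans[OF skip] that(3) by simp
  qed (use that two in auto)
  define \<rho> where "\<rho> = i mod r"
  have \<rho>: "0 \<le> \<rho>" "\<rho> \<le> r - 1" unfolding \<rho>_def using r3 pos_mod_bound[of r i] by simp_all
  have "con False i 0 \<rho> 0" using con_period[OF dvd_minus_mod] unfolding \<rho>_def by blast
  moreover have "con False \<rho> 0 0 0"
  proof -
    consider "\<rho> = 0" | "odd \<rho>" "1 \<le> \<rho>" | "even \<rho>" "2 \<le> \<rho>" using \<rho> by fastforce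
    then show ?thesis by cases (use odd even \<rho> con_refl in auto)
  qed
  ultimately show "con False i 0 0 0" by (rule con_trans)
qed

lemma blue_hubs: "con False i 0 0 0"
  using blue_hubs_generic blue_hubs_degenerate by blast

lemma blue_connected:
  assumes i: "0 \<le> i" "i < r" and j: "0 \<le> j" "j < q"
  shows "con False i j 0 0"
proof -
  \<comment> \<open>The regions are: the zigzag columns; the rows above the diagonal; left of, on
    and right of the diagonal; row 0 where it coincides with row \<open>r\<close>.\<close>
  consider "j \<le> c" | "c < j" "\<gamma> \<le> i" | "c < j" "i \<le> \<gamma> - 1" "j \<le> c + i - 1"
    | "1 \<le> i" "i \<le> \<gamma> - 1" "j = c + i"
    | "i \<le> \<gamma> - 1" "c + i + 1 \<le> j" "1 \<le> i \<or> \<gamma> - 1 < r"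
    | "i = 0" "c < j" "\<not> \<gamma> - 1 < r"
    using i j by linarith
  then have "\<exists>i'. con False i j i' 0"
  proof cases
    case 1
    then show ?thesis using blue_left j by blast
  next
    case 2
    have "con False i 0 i j"
    proof (rule blue_plain_row)
      fix \<rho> assume "0 \<le> \<rho>" "\<rho> \<le> \<gamma> - 1"
      then show "\<not> r dvd (i - \<rho>)" using not_dvd[of "i - \<rho>"] 2 i by simp
    qed (use 2 j in auto)
    then show ?thesis using con_sym by blast
  next
    case 3
    then show ?thesis using con_sym[OF blue_row_left[of i j]] i by auto
  next
    case 4
    show ?thesis
    proof (cases "1 \<le> i - 1 \<or> \<gamma> - 1 < r")
      case True
      then show ?thesis using blue_diag_high[of "i - 1"] 4 by auto
    next
      case False
      then have "i = 1" using 4 by simp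
      then show ?thesis using blue_hubs_degenerate(2) False 4 by blast
    qed
  next
    case 5
    then show ?thesis using blue_row_right[of i j] i j by auto
  next
    case 6
    have gm: "\<gamma> = r + 1" "g = r" using 6 gamma_bounds g_dvd by simp_all
    show ?thesis
    proof (cases "j < N")
      case True
      have "con False 1 (c + 1) 0 (c + 1)"
        using con_sym[OF blue_square(2)[of c]] h_diag[of 0] c_bounds by simp
      also have "con False 0 (c + 1) 0 j"
      proof (rule blue_row)
        fix e assume e: "c + 1 \<le> e" "e < j"
        then have "h e = e - c" using h_diag[of "e - c"] by simp
        then show "\<not> r dvd (0 - h e) \<and> \<not> r dvd (0 - 1 - h e)"
          using not_dvd_neg[of "0 - (e - c)"] not_dvd_neg[of "0 - 1 - (e - c)"] e True c_bounds gm by simp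
      qed (use 6 c_bounds j in auto)
      finally have "con False 1 (c + 1) 0 j" .
      then show ?thesis using con_trans[OF con_sym blue_hubs_degenerate(2)] 6 by blast
    next
      case False
      have "con False 0 j 0 q" by (rule blue_row) (use False j in auto)
      also have "con False 0 q (0 + k) 0" by (rule con_wrap)
      finally show ?thesis using 6 by blast
    qed
  qed
  then obtain i' where "con False i j i' 0" ..
  then show ?thesis using blue_hubs by (rule con_trans)
qed

section \<open>The two Hamilton cycles of the torus\<close>

lemma R_connected:
  assumes "x \<in> V" "y \<in> V"
  shows "(R b)\<^sup>*\<^sup>* x y"
proof -
  obtain i j where x: "0 \<le> i" "i < r" "0 \<le> j" "j < q" "x = \<phi> i j" using coordinates[OF assms(1)] .
  obtain i' j' where y: "0 \<le> i'" "i' < r" "0 \<le> j'" "j' < q" "y = \<phi> i' j'" using coordinates[OF assms(2)] .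
  have "con b i j (h 0) 0" "con b i' j' (h 0) 0"
    using red_connected blue_connected x y h_zero by (cases b; simp)+
  then have "con b i j i' j'" using con_trans con_sym by metis
  then show ?thesis unfolding con_def x y .
qed

lemma hamilton_decomposition:
  obtains F1 F1' F2 F2' where "\<And>F. F \<in> {F1, F1', F2, F2'} \<Longrightarrow> circulates F V"
    and "\<And>x. x \<in> V \<Longrightarrow> F1 (F1' x) = x \<and> F1' (F1 x) = x \<and> F2 (F2' x) = x \<and> F2' (F2 x) = x"
    and "\<And>i j. mset [F1 (\<phi> i j), F1' (\<phi> i j), F2 (\<phi> i j), F2' (\<phi> i j)] =
      mset [\<phi> (i + 1) j, \<phi> (i - 1) j, \<phi> i (j + 1), \<phi> i (j - 1)]"
proof -
  have "V \<noteq> {}" using phi_in by blast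
  note orient = two_regular_connected_circulates[OF finite_V this]
  obtain F1 F1' where 1: "circulates F1 V" "circulates F1' V" "\<And>x. x \<in> V \<Longrightarrow> F1 (F1' x) = x"
    "\<And>x. x \<in> V \<Longrightarrow> F1' (F1 x) = x" "\<And>x. x \<in> V \<Longrightarrow> {y. R True x y} = {F1 x, F1' x}"
    "\<And>x. x \<in> V \<Longrightarrow> F1 x \<noteq> F1' x"
    by (rule orient[where R = "R True"]) (rule R_sym R_dom R_irrefl R_two R_connected; assumption | blast)+
  obtain F2 F2' where 2: "circulates F2 V" "circulates F2' V" "\<And>x. x \<in> V \<Longrightarrow> F2 (F2' x) = x"
    "\<And>x. x \<in> V \<Longrightarrow> F2' (F2 x) = x" "\<And>x. x \<in> V \<Longrightarrow> {y. R False x y} = {F2 x, F2' x}"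
    "\<And>x. x \<in> V \<Longrightarrow> F2 x \<noteq> F2' x"
    by (rule orient[where R = "R False"]) (rule R_sym R_dom R_irrefl R_two R_connected; assumption | blast)+
  have "mset [F1 (\<phi> i j), F1' (\<phi> i j), F2 (\<phi> i j), F2' (\<phi> i j)] =
      mset [\<phi> (i + 1) j, \<phi> (i - 1) j, \<phi> i (j + 1), \<phi> i (j - 1)]" for i j
  proof -
    let ?l = "[F1 (\<phi> i j), F1' (\<phi> i j), F2 (\<phi> i j), F2' (\<phi> i j)]"
    let ?r = "[\<phi> (i + 1) j, \<phi> (i - 1) j, \<phi> i (j + 1), \<phi> i (j - 1)]"
    have s: "set ?l = set ?r"
      using R_split[of i j] 1(5)[OF phi_in] 2(5)[OF phi_in] by (simp add: insert_commute Un_insert_left)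
    have "card (set ?r) = length ?l" using distinct_card[OF four_neighbours] by simp
    then have "distinct ?l" using s by (intro card_distinct) (simp only: s)
    then show ?thesis using s four_neighbours set_eq_iff_mset_eq_distinct by blast
  qed
  then show ?thesis using that[of F1 F1' F2 F2'] 1 2 by blast
qed

end

section \<open>Connected circulants with two jumps\<close>

lemma int_subgroup_multiples:
  fixes A :: "int set"
  assumes "M \<in> A" "M > 0" and add: "\<And>x y. x \<in> A \<Longrightarrow> y \<in> A \<Longrightarrow> x + y \<in> A"
    and neg: "\<And>x. x \<in> A \<Longrightarrow> - x \<in> A"
  shows "\<exists>d>0. \<forall>x. x \<in> A \<longleftrightarrow> d dvd x"
proof -
  define P where "P d \<longleftrightarrow> 0 < d \<and> int d \<in> A" for d :: nat
  have "P (nat M)" unfolding P_def using assms by simp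
  then obtain d where d: "P d" "\<And>e. e < d \<Longrightarrow> \<not> P e" using exists_least_iff[of P] by blast
  have mul_nat: "int d * int e \<in> A" for e
  proof (induction e)
    case 0
    then show ?case using add[of M "- M"] neg assms by simp
  next
    case (Suc e)
    then show ?case using add[of "int d" "int d * int e"] d unfolding P_def by (simp add: algebra_simps)
  qed
  have mul: "int d * e \<in> A" for e
    using mul_nat[of "nat e"] neg[OF mul_nat[of "nat (- e)"]] by (cases "e \<ge> 0") simp_all
  have "int d dvd x" if x: "x \<in> A" for x
  proof -
    have "x mod int d = x + int d * (- (x div int d))" by (simp add: minus_mult_div_eq_mod)
    then have "x mod int d \<in> A" using add[OF x mul[of "- (x div int d)"]] by simp
    moreover have "0 \<le> x mod int d" "x mod int d < int d" using d unfolding P_def by simp_all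
    ultimately have "x mod int d = 0"
      using d(2)[of "nat (x mod int d)"] unfolding P_def by (simp add: nat_less_iff)
    then show ?thesis by (simp add: dvd_eq_mod_eq_0)
  qed
  moreover have "x \<in> A" if "int d dvd x" for x using that mul by auto
  ultimately show ?thesis using d unfolding P_def by (metis of_nat_0_less_iff)
qed

text \<open>This is the Hermite normal form: \<open>q\<close> generates the second projection of the
  lattice, \<open>r\<close> its part on the first axis, and \<open>(- k, q)\<close> is a lift of
  \<open>q\<close>. The first projection is recorded for comparison with the transposed
  lattice.\<close>

lemma lattice_normal_form:
  fixes L :: "int \<Rightarrow> int \<Rightarrow> bool"
  assumes add: "\<And>i j i' j'. L i j \<Longrightarrow> L i' j' \<Longrightarrow> L (i + i') (j + j')"
    and neg: "\<And>i j. L i j \<Longrightarrow> L (- i) (- j)"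
    and M: "M > 0" "L M 0" "L 0 M"
  obtains r q k where "r > 0" "q > 0"
    and "\<And>i j. L i j \<longleftrightarrow> q dvd j \<and> r dvd (i + k * (j div q))"
    and "\<And>j. (\<exists>i. L i j) \<longleftrightarrow> q dvd j" and "\<And>i. (\<exists>j. L i j) \<longleftrightarrow> gcd r k dvd i"
proof -
  have "\<exists>d>0. \<forall>x. x \<in> {j. \<exists>i. L i j} \<longleftrightarrow> d dvd x"
  proof (rule int_subgroup_multiples[of M])
    fix x y assume "x \<in> {j. \<exists>i. L i j}" "y \<in> {j. \<exists>i. L i j}"
    then show "x + y \<in> {j. \<exists>i. L i j}" using add by blast
  next
    fix x assume "x \<in> {j. \<exists>i. L i j}"
    then show "- x \<in> {j. \<exists>i. L i j}" using neg by blast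
  qed (use M in auto)
  then obtain q where q: "q > 0" "\<And>j. (\<exists>i. L i j) \<longleftrightarrow> q dvd j" by auto
  have "\<exists>d>0. \<forall>x. x \<in> {i. L i 0} \<longleftrightarrow> d dvd x"
  proof (rule int_subgroup_multiples[of M])
    fix x y assume "x \<in> {i. L i 0}" "y \<in> {i. L i 0}"
    then show "x + y \<in> {i. L i 0}" using add[of x 0 y 0] by simp
  next
    fix x assume "x \<in> {i. L i 0}"
    then show "- x \<in> {i. L i 0}" using neg[of x 0] by simp
  qed (use M in auto)
  then obtain r where r: "r > 0" "\<And>i. L i 0 \<longleftrightarrow> r dvd i" by auto
  obtain i0 where "L i0 q" using q(2)[of q] by auto
  then obtain k where k: "L (- k) q" by (metis minus_minus)
  have mul_nat: "L (- (k * int e)) (q * int e)" for e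
  proof (induction e)
    case 0
    then show ?case using r(2)[of 0] by simp
  next
    case (Suc e)
    then show ?case using add[OF k Suc] by (simp add: algebra_simps)
  qed
  have mul: "L (- (k * e)) (q * e)" for e
    using mul_nat[of "nat e"] neg[OF mul_nat[of "nat (- e)"]] by (cases "e \<ge> 0") simp_all
  have L: "L i j \<longleftrightarrow> q dvd j \<and> r dvd (i + k * (j div q))" for i j
  proof
    assume a: "L i j"
    then have qj: "q dvd j" using q by blast
    then have "j = q * (j div q)" by simp
    then have "L (i + k * (j div q)) 0" using add[OF a neg[OF mul[of "j div q"]]] by simp
    then show "q dvd j \<and> r dvd (i + k * (j div q))" using qj r by blast
  next
    assume a: "q dvd j \<and> r dvd (i + k * (j div q))"
    then have "L (i + k * (j div q)) 0" using r by blast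
    then show "L i j" using add[OF _ mul[of "j div q"]] a by fastforce
  qed
  have "(\<exists>j. L i j) \<longleftrightarrow> gcd r k dvd i" for i
  proof
    assume "\<exists>j. L i j"
    then obtain e where "r dvd (i + k * e)" using L by blast
    then have "gcd r k dvd (i + k * e)" using dvd_trans gcd_dvd1 by blast
    then show "gcd r k dvd i" by (simp add: dvd_add_left_iff)
  next
    assume "gcd r k dvd i"
    then obtain z where z: "i = gcd r k * z" by blast
    obtain x y where "x * r + y * k = gcd r k" using bezout_int[of r k] by blast
    then have "i = (x * r + y * k) * z" using z by simp
    then have "i = r * (x * z) + k * (y * z)" by (simp add: algebra_simps)
    then have "r dvd (i + k * (- (y * z)))" by simp
    then have "L i (q * (- (y * z)))" unfolding L using q(1) by (metis dvd_triv_left nonzero_mult_div_cancel_left order_less_irrefl)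
    then show "\<exists>j. L i j" by blast
  qed
  then show ?thesis using that[of r q k] r(1) q L by blast
qed

text \<open>The number \<open>gcd r k\<close> of row classes equals the number \<open>q'\<close> of
  columns of the transposed lattice. So the bound \<open>gq\<close> holds for the lattice or for its
  transpose.\<close>

lemma lattice_hamilton_decomposition:
  fixes \<phi> :: "int \<Rightarrow> int \<Rightarrow> 'v" and L :: "int \<Rightarrow> int \<Rightarrow> bool"
  assumes phi: "\<And>i j i' j'. \<phi> i j = \<phi> i' j' \<longleftrightarrow> L (i - i') (j - j')"
    and add: "\<And>i j i' j'. L i j \<Longrightarrow> L i' j' \<Longrightarrow> L (i + i') (j + j')"
    and neg: "\<And>i j. L i j \<Longrightarrow> L (- i) (- j)"
    and M: "M > 0" "L M 0" "L 0 M"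
    and nd: "\<not> L 2 0" "\<not> L 0 2" "\<not> L 1 1" "\<not> L 1 (- 1)"
  obtains F1 F1' F2 F2' where "\<And>F. F \<in> {F1, F1', F2, F2'} \<Longrightarrow> circulates F {\<phi> i j | i j. True}"
    and "\<And>x. x \<in> {\<phi> i j | i j. True} \<Longrightarrow>
      F1 (F1' x) = x \<and> F1' (F1 x) = x \<and> F2 (F2' x) = x \<and> F2' (F2 x) = x"
    and "\<And>i j. mset [F1 (\<phi> i j), F1' (\<phi> i j), F2 (\<phi> i j), F2' (\<phi> i j)] =
      mset [\<phi> (i + 1) j, \<phi> (i - 1) j, \<phi> i (j + 1), \<phi> i (j - 1)]"
proof -
  have nd': "\<not> L (- 1) 1" using neg[of "- 1" 1] nd by auto
  obtain r q k where n: "r > 0" "q > 0" "\<And>i j. L i j \<longleftrightarrow> q dvd j \<and> r dvd (i + k * (j div q))"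
    "\<And>j. (\<exists>i. L i j) \<longleftrightarrow> q dvd j" "\<And>i. (\<exists>j. L i j) \<longleftrightarrow> gcd r k dvd i"
    by (rule lattice_normal_form[of L M]) (rule M neg add that; assumption)+
  obtain r' q' k' where n': "r' > 0" "q' > 0" "\<And>i j. L j i \<longleftrightarrow> q' dvd j \<and> r' dvd (i + k' * (j div q'))"
    "\<And>j. (\<exists>i. L j i) \<longleftrightarrow> q' dvd j" "\<And>i. (\<exists>j. L j i) \<longleftrightarrow> gcd r' k' dvd i"
    by (rule lattice_normal_form[of "\<lambda>i j. L j i" M]) (rule M neg add that; assumption)+
  have ass: "x = y" if "\<And>i. x dvd i \<longleftrightarrow> y dvd i" "x \<ge> 0" "y \<ge> 0" for x y :: int
    using zdvd_antisym_nonneg[OF that(2,3)] that(1)[of x] that(1)[of y] by simp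
  have g: "gcd r k = q'" using ass[of "gcd r k" q'] n(5) n'(2,4) by simp
  have g': "gcd r' k' = q" using ass[of "gcd r' k'" q] n'(5) n(2,4) by simp
  have ge3: "r \<ge> 3" if "r > 0" "\<not> r dvd 2" for r :: int
  proof -
    have "r \<noteq> 1" "r \<noteq> 2" using that by auto
    then show ?thesis using that by simp
  qed
  show ?thesis
  proof (cases "q' \<le> q")
    case True
    interpret torus \<phi> r q k
    proof
      show "r \<ge> 3" using ge3[of r] n(1) nd(1) n(3)[of 2 0] by simp
    qed (use n True g nd nd' phi in \<open>auto simp: phi n(3)\<close>)
    show ?thesis by (rule hamilton_decomposition[unfolded V_def]) (rule that)
  next
    case False
    interpret torus "\<lambda>i j. \<phi> j i" r' q' k'
    proof
      show "r' \<ge> 3" using ge3[of r'] n'(1) nd(2) n'(3)[of 0 2] by simp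
    qed (use n' False g' nd nd' phi in \<open>auto simp: phi n'(3)\<close>)
    have V: "V = {\<phi> i j | i j. True}" unfolding V_def by blast
    obtain F1 F1' F2 F2' where *: "\<And>F. F \<in> {F1, F1', F2, F2'} \<Longrightarrow> circulates F V"
      "\<And>x. x \<in> V \<Longrightarrow> F1 (F1' x) = x \<and> F1' (F1 x) = x \<and> F2 (F2' x) = x \<and> F2' (F2 x) = x"
      "\<And>i j. mset [F1 (\<phi> j i), F1' (\<phi> j i), F2 (\<phi> j i), F2' (\<phi> j i)] =
        mset [\<phi> j (i + 1), \<phi> j (i - 1), \<phi> (j + 1) i, \<phi> (j - 1) i]"
      by (rule hamilton_decomposition) (rule that)
    have "mset [F1 (\<phi> i j), F1' (\<phi> i j), F2 (\<phi> i j), F2' (\<phi> i j)] =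
        mset [\<phi> (i + 1) j, \<phi> (i - 1) j, \<phi> i (j + 1), \<phi> i (j - 1)]" for i j
      using *(3)[of i j] by (simp add: add_mset_commute)
    then show ?thesis using that[of F1 F1' F2 F2'] *(1,2) unfolding V by blast
  qed
qed

text \<open>Here \<open>\<phi> i j\<close> is the element \<open>i (a, 1) + j (b, 1)\<close> of
  \<open>Z_n \<times> Z_w\<close>, with kernel \<open>L\<close>; the natural number
  \<open>n - a\<close> stands for \<open>- a\<close>.\<close>

lemma circulant_hamilton_decomposition:
  fixes n a b w :: nat
  assumes w: "w = 1 \<or> w = 2" and a: "0 < a" "2 * a < n" and b: "0 < b" "2 * b < n"
    and ab: "odd (a + b)" and gcd: "gcd (gcd a b) n = 1"
  obtains F1 F1' F2 F2' where "\<And>F. F \<in> {F1, F1', F2, F2'} \<Longrightarrow> circulates F ({..<n} \<times> {..<w})"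
    and "\<And>x. x \<in> {..<n} \<times> {..<w} \<Longrightarrow>
      F1 (F1' x) = x \<and> F1' (F1 x) = x \<and> F2 (F2' x) = x \<and> F2' (F2 x) = x"
    and "\<And>x y. x < n \<Longrightarrow> y < w \<Longrightarrow> mset [F1 (x, y), F1' (x, y), F2 (x, y), F2' (x, y)] =
      mset (map (\<lambda>l. ((x + l) mod n, Suc y mod w)) [a, n - a, b, n - b])"
proof -
  define \<phi> where "\<phi> i j = (nat ((i * int a + j * int b) mod int n), nat ((i + j) mod int w))" for i j
  define L where "L i j \<longleftrightarrow> int n dvd (i * int a + j * int b) \<and> int w dvd (i + j)" for i j
  have n0: "n > 0" "w > 0" using a w by auto
  have nat_mod: "nat (x mod int m) = nat (y mod int m) \<longleftrightarrow> int m dvd (x - y)" if "m > 0" for x y m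
    using that by (simp add: eq_nat_nat_iff mod_eq_dvd_iff)
  have phi: "\<phi> i j = \<phi> i' j' \<longleftrightarrow> L (i - i') (j - j')" for i j i' j'
    unfolding \<phi>_def L_def using nat_mod n0 by (simp add: algebra_simps)
  have add: "L (i + i') (j + j')" if "L i j" "L i' j'" for i j i' j'
  proof -
    have "(i + i') * int a + (j + j') * int b = (i * int a + j * int b) + (i' * int a + j' * int b)"
      "(i + i') + (j + j') = (i + j) + (i' + j')" by (simp_all add: algebra_simps)
    then show ?thesis using that unfolding L_def by (metis dvd_add)
  qed
  have neg: "L (- i) (- j)" if "L i j" for i j
  proof -
    have "(- i) * int a + (- j) * int b = - (i * int a + j * int b)" "(- i) + (- j) = - (i + j)" by simp_all
    then show ?thesis using that unfolding L_def by (metis dvd_minus_iff)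
  qed
  have nds: "\<not> int n dvd x" if "x \<noteq> 0" "\<bar>x\<bar> < int n" for x
    using that dvd_imp_le_int by force
  have "a \<noteq> b" using ab by auto
  have nd: "\<not> L 2 0" "\<not> L 0 2" "\<not> L 1 1" "\<not> L 1 (- 1)"
    unfolding L_def using nds[of "2 * int a"] nds[of "2 * int b"] nds[of "int a + int b"] nds[of "int a - int b"] a b \<open>a \<noteq> b\<close>
    by auto
  have V: "{\<phi> i j | i j. True} = {..<n} \<times> {..<w}"
  proof
    show "{\<phi> i j | i j. True} \<subseteq> {..<n} \<times> {..<w}"
      unfolding \<phi>_def using n0 by (auto simp: nat_less_iff)
    show "{..<n} \<times> {..<w} \<subseteq> {\<phi> i j | i j. True}"
    proof (clarify)
      fix x y assume xy: "x < n" "y < w"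
      obtain u v where "u * int a + v * int b = gcd (int a) (int b)" using bezout_int by blast
      moreover obtain s t where "s * gcd (int a) (int b) + t * int n = gcd (gcd (int a) (int b)) (int n)"
        using bezout_int by blast
      moreover have "gcd (gcd (int a) (int b)) (int n) = 1" using gcd by (metis gcd_int_int_eq of_nat_1)
      ultimately have "s * (u * int a + v * int b) + t * int n = 1" by simp
      then have *: "int x = (int x * s * u) * int a + (int x * s * v) * int b + (int x * t) * int n"
        by (metis (no_types, lifting) distrib_left mult.assoc mult.right_neutral)
      define i j where ij: "i = int x * s * u" "j = int x * s * v"
      have fst: "(i * int a + j * int b) mod int n = int x"
      proof -
        have "i * int a + j * int b = int x - (int x * t) * int n" using * unfolding ij by linarith
        then have "(i * int a + j * int b) mod int n = int x mod int n" by (simp add: mod_eq_dvd_iff)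
        then show ?thesis using xy by simp
      qed
      have "\<exists>i j. (i * int a + j * int b) mod int n = int x \<and> (i + j) mod int w = int y"
      proof (cases "(i + j) mod int w = int y")
        case True
        then show ?thesis using fst by blast
      next
        case False
        have w2: "w = 2" using False w xy by auto
        \<comment> \<open>Adding \<open>(b, - a)\<close> to \<open>(i, j)\<close> keeps the first
          component and changes the parity of the second, because \<open>b - a\<close> is
          odd.\<close>
        have "(i + int b) * int a + (j - int a) * int b = i * int a + j * int b" by (simp add: algebra_simps)
        moreover have "(i + int b + (j - int a)) mod 2 = int y"
        proof -
          have "y = 0 \<or> y = 1" using xy w2 by auto
          moreover have "(i + j) mod 2 \<noteq> int y" using False w2 by simp
          moreover have "odd (int b - int a)" using ab by simp
          moreover have "i + int b + (j - int a) = (i + j) + (int b - int a)" by simp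
          ultimately show ?thesis by presburger
        qed
        ultimately show ?thesis using fst w2 by (metis of_nat_numeral)
      qed
      then obtain i j where "(i * int a + j * int b) mod int n = int x" "(i + j) mod int w = int y" by blast
      then have "\<phi> i j = (x, y)" unfolding \<phi>_def by simp
      then show "\<exists>i j. (x, y) = \<phi> i j \<and> True" by metis
    qed
  qed
  have M: "int (n * w) > 0" "L (int (n * w)) 0" "L 0 (int (n * w))" using n0 unfolding L_def by auto
  obtain F1 F1' F2 F2' where F: "\<And>F. F \<in> {F1, F1', F2, F2'} \<Longrightarrow> circulates F ({..<n} \<times> {..<w})"
    "\<And>x. x \<in> {..<n} \<times> {..<w} \<Longrightarrow>
      F1 (F1' x) = x \<and> F1' (F1 x) = x \<and> F2 (F2' x) = x \<and> F2' (F2 x) = x"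
    "\<And>i j. mset [F1 (\<phi> i j), F1' (\<phi> i j), F2 (\<phi> i j), F2' (\<phi> i j)] =
      mset [\<phi> (i + 1) j, \<phi> (i - 1) j, \<phi> i (j + 1), \<phi> i (j - 1)]"
    by (rule lattice_hamilton_decomposition[of \<phi> L, unfolded V]) (rule M nd phi neg add that; assumption)+
  have "mset [F1 (x, y), F1' (x, y), F2 (x, y), F2' (x, y)] =
      mset (map (\<lambda>l. ((x + l) mod n, Suc y mod w)) [a, n - a, b, n - b])" if xy: "x < n" "y < w" for x y
  proof -
    have "(x, y) \<in> {\<phi> i j | i j. True}" using xy V by simp
    then obtain i j where ij: "\<phi> i j = (x, y)" by auto
    then have x: "(i * int a + j * int b) mod int n = int x" and y: "(i + j) mod int w = int y"
      unfolding \<phi>_def using n0 by (auto simp: nat_eq_iff)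
    have sh: "nat ((i * int a + j * int b + e) mod int n) = (x + l) mod n"
      if "int n dvd (e - int l)" for e l
    proof -
      have "(i * int a + j * int b + e) mod int n = (int x + int l) mod int n"
        using x that by (metis mod_add_cong mod_eq_dvd_iff mod_mod_trivial)
      then show ?thesis by (metis nat_int of_nat_add zmod_int)
    qed
    have sw: "nat ((i + j + e) mod int w) = Suc y mod w" if "int w dvd (e - 1)" for e
    proof -
      have "(i + j + e) mod int w = (int y + 1) mod int w"
        using y that by (metis mod_add_cong mod_eq_dvd_iff mod_mod_trivial)
      then show ?thesis by (metis nat_int of_nat_Suc zmod_int add.commute)
    qed
    \<comment> \<open>With at most two layers a backward step also leads to the next layer.\<close>
    have w2: "int w dvd (- 1 - 1)" using w by auto
    have "\<phi> (i + 1) j = ((x + a) mod n, Suc y mod w)"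
      using sh[of "int a" a] sw[of 1] unfolding \<phi>_def by (simp add: algebra_simps)
    moreover have "\<phi> i (j + 1) = ((x + b) mod n, Suc y mod w)"
      using sh[of "int b" b] sw[of 1] unfolding \<phi>_def by (simp add: algebra_simps)
    moreover have "\<phi> (i - 1) j = ((x + (n - a)) mod n, Suc y mod w)"
      using sh[of "- int a" "n - a"] sw[OF w2] a unfolding \<phi>_def by (simp add: algebra_simps)
    moreover have "\<phi> i (j - 1) = ((x + (n - b)) mod n, Suc y mod w)"
      using sh[of "- int b" "n - b"] sw[OF w2] b unfolding \<phi>_def by (simp add: algebra_simps)
    ultimately show ?thesis using F(3)[of i j] unfolding ij by simp
  qed
  then show ?thesis using that[of F1 F1' F2 F2'] F(1,2) by blast
qed

text \<open>After the first \<open>w\<close> layers the steps cancel in pairs, so that going once around \<open>m\<close> layers has the effect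
  of \<open>F ^^ w\<close>; both \<open>w = 1\<close> and \<open>w = 2\<close> are needed since \<open>m\<close> and \<open>w\<close> must have the same parity.\<close>

definition layered :: "nat \<Rightarrow> nat \<Rightarrow> (nat \<times> nat \<Rightarrow> nat \<times> nat) \<Rightarrow> (nat \<times> nat \<Rightarrow> nat \<times> nat) \<Rightarrow>
    nat \<times> nat \<Rightarrow> nat \<times> nat" where
  "layered w m F F' = (\<lambda>(x, j).
     (fst (if j < w \<or> even (j - w) then F (x, j mod w) else F' (x, j mod w)), Suc j mod m))"

text \<open>The return map to layer 0 is \<open>F ^^ w\<close> for both permutations. It is
  transitive there because \<open>F\<close> is a single cycle through all its layers, and every
  point flows into layer 0.\<close>

lemma layered_circulates:
  fixes n w m :: nat
  defines "V \<equiv> {..<n} \<times> {..<w}"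
  assumes n: "n > 0" and w: "w > 0" and m: "w \<le> m" "even (m - w)"
    and F: "circulates F V" and F': "circulates F' V" and inv: "\<And>v. v \<in> V \<Longrightarrow> F' (F v) = v"
    and snd_F: "\<And>x y. (x, y) \<in> V \<Longrightarrow> snd (F (x, y)) = Suc y mod w \<and> snd (F' (x, y)) = Suc y mod w"
  shows "circulates (layered w m F F') ({..<n} \<times> {..<m})"
proof -
  define G where "G = layered w m F F'"
  have G_fwd: "G (z, j) = (fst (F (z, j mod w)), Suc j mod m)" if "j < w \<or> even (j - w)" for z j
    using that unfolding G_def layered_def by simp
  have G_bwd: "G (z, j) = (fst (F' (z, j mod w)), Suc j mod m)" if "\<not> (j < w \<or> even (j - w))" for z j
    using that unfolding G_def layered_def by simp
  let ?W = "{..<n} \<times> {..<m}"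
  have bF: "bij_betw F V V" and bF': "bij_betw F' V V" using F F' unfolding circulates_def by blast+
  have FV: "F v \<in> V" "F' v \<in> V" if "v \<in> V" for v using that bF bF' bij_betwE by blast+
  have m0: "m > 0" using w m by simp
  have inV: "(x, j mod w) \<in> V" if "x < n" for x j using that w unfolding V_def by simp
  have G_in: "G v \<in> ?W" if "v \<in> ?W" for v
  proof -
    obtain x j where v: "v = (x, j)" "x < n" "j < m" using \<open>v \<in> ?W\<close> by auto
    have "fst (F (x, j mod w)) < n" "fst (F' (x, j mod w)) < n"
      using FV[OF inV[OF v(2), of j]] unfolding V_def by (auto simp: mem_Times_iff)
    then show ?thesis using m0 unfolding v G_def layered_def by simp
  qed
  have "inj_on G ?W"
  proof (rule inj_onI)
    fix v v' assume vv: "v \<in> ?W" "v' \<in> ?W" "G v = G v'"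
    obtain x j where v: "v = (x, j)" "x < n" "j < m" using vv by auto
    obtain x' j' where v': "v' = (x', j')" "x' < n" "j' < m" using vv by auto
    have "Suc j mod m = Suc j' mod m" using vv(3) unfolding G_def layered_def v v' by simp
    then have j: "j = j'" using v v' by (auto simp: mod_Suc split: if_splits)
    define K where "K = (if j < w \<or> even (j - w) then F else F')"
    have K: "inj_on K V" using bF bF' bij_betw_imp_inj_on unfolding K_def by auto
    have "fst (K (x, j mod w)) = fst (K (x', j mod w))"
      using vv(3) unfolding G_def layered_def v v' j[symmetric] K_def by (auto split: if_splits)
    moreover have "snd (K (x, j mod w)) = snd (K (x', j mod w))"
      using snd_F[OF inV[OF v(2), of j]] snd_F[OF inV[OF v'(2), of j]] unfolding K_def by simp
    ultimately have "K (x, j mod w) = K (x', j mod w)" by (rule prod_eqI)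
    then have "(x, j mod w) = (x', j mod w)" using K inV v v' by (meson inj_onD)
    then show "v = v'" using v v' j by simp
  qed
  moreover have "G ` ?W \<subseteq> ?W" using G_in by (rule image_subsetI)
  moreover have "finite ?W" by simp
  ultimately have bij: "bij_betw G ?W ?W"
    using endo_inj_surj[of ?W G] unfolding bij_betw_def by blast
  have snd_G: "snd ((G ^^ e) (x, j)) = (j + e) mod m" if "j < m" for x j e
  proof (induction e)
    case (Suc e)
    have "snd (G u) = Suc (snd u) mod m" for u unfolding G_def layered_def by (simp add: case_prod_beta)
    then show ?case using Suc by (simp add: mod_Suc_eq)
  qed (use that in simp)
  have pow_in: "(F ^^ e) v \<in> V" if "v \<in> V" for e v using funpow_in[OF bF that] .
  have snd_pow: "snd ((F ^^ e) (x, 0)) = e mod w" if "x < n" for x e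
  proof (induction e)
    case (Suc e)
    obtain z y where zy: "(F ^^ e) (x, 0) = (z, y)" by fastforce
    then have "(z, y) \<in> V" using pow_in[of "(x, 0)" e] inV[OF that, of 0] by simp
    then show ?case using Suc snd_F[of z y] zy by (simp add: mod_Suc_eq)
  qed simp
  have head: "(G ^^ e) (x, 0) = (fst ((F ^^ e) (x, 0)), e mod m)" if x: "x < n" and e: "e \<le> w" for x e
    using e
  proof (induction e)
    case (Suc e)
    have e: "e < w" "e < m" using Suc.prems m by simp_all
    have "(fst ((F ^^ e) (x, 0)), e) = (F ^^ e) (x, 0)" using snd_pow[OF x, of e] e by (simp add: prod_eq_iff)
    then have "G (fst ((F ^^ e) (x, 0)), e) = (fst (F ((F ^^ e) (x, 0))), Suc e mod m)"
      using G_fwd[of e "fst ((F ^^ e) (x, 0))"] e by simp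
    then show ?case using Suc e by simp
  qed simp
  have pair: "G (G (z, j)) = (z, Suc (Suc j) mod m)" if z: "z < n" and j: "w \<le> j" "Suc j < m" "even (j - w)" for z j
  proof -
    have "Suc j mod w = snd (F (z, j mod w))" using snd_F[OF inV[OF z]] by (simp add: mod_Suc_eq)
    then have "(fst (F (z, j mod w)), Suc j mod w) = F (z, j mod w)" by simp
    then have "F' (fst (F (z, j mod w)), Suc j mod w) = (z, j mod w)" using inv[OF inV[OF z]] by simp
    moreover have "odd (Suc j - w)" using j by (simp add: Suc_diff_le)
    ultimately show ?thesis using j G_fwd[of j z] G_bwd[of "Suc j" "fst (F (z, j mod w))"] by simp
  qed
  have tail: "(G ^^ (w + 2 * l)) (x, 0) = (fst ((F ^^ w) (x, 0)), (w + 2 * l) mod m)"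
    if x: "x < n" and l: "w + 2 * l \<le> m" for x l
    using l
  proof (induction l)
    case 0
    then show ?case using head[OF x, of w] by simp
  next
    case (Suc l)
    have "(F ^^ w) (x, 0) \<in> V" using pow_in inV[OF x, of 0] by simp
    then have "fst ((F ^^ w) (x, 0)) < n" unfolding V_def by (auto simp: mem_Times_iff)
    then show ?case using Suc pair[of "fst ((F ^^ w) (x, 0))" "w + 2 * l"] by simp
  qed
  have round: "(G ^^ m) (x, 0) = (F ^^ w) (x, 0)" if x: "x < n" for x
  proof -
    have "(G ^^ m) (x, 0) = (fst ((F ^^ w) (x, 0)), 0)" using tail[OF x, of "(m - w) div 2"] m by simp
    moreover have "snd ((F ^^ w) (x, 0)) = 0" using snd_pow[OF x] by simp
    ultimately show ?thesis by (simp add: prod_eq_iff)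
  qed
  have rounds: "(G ^^ (m * e)) (x, 0) = (F ^^ (w * e)) (x, 0)" if x: "x < n" for x e
  proof (induction e)
    case (Suc e)
    let ?z = "(F ^^ (w * e)) (x, 0)"
    have "?z \<in> V" using pow_in inV[OF x, of 0] by simp
    then have "fst ?z < n" unfolding V_def by (auto simp: mem_Times_iff)
    moreover have "?z = (fst ?z, 0)" using snd_pow[OF x, of "w * e"] by (simp add: prod_eq_iff)
    ultimately have "(G ^^ m) ?z = (F ^^ w) ?z" using round by metis
    then show ?case using Suc by (simp add: funpow_add)
  qed simp
  have "circulates G ?W"
  proof (rule circulatesI_hub[OF _ bij, of "(0, 0)"])
    fix v assume v: "v \<in> ?W"
    obtain x j where xj: "v = (x, j)" "x < n" "j < m" using v by auto
    let ?u = "(G ^^ (m - j)) v"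
    have "?u \<in> ?W" using funpow_in[OF bij v] .
    then have x': "fst ?u < n" by (auto simp: mem_Times_iff)
    have "snd ?u = 0" unfolding xj(1) using snd_G[OF xj(3), of "m - j" x] xj(3) by simp
    then have u: "?u = (fst ?u, 0)" by (simp add: prod_eq_iff)
    have "(fst ?u, 0) \<in> V" "(0, 0) \<in> V" using inV[OF x', of 0] inV[OF n, of 0] by simp_all
    \<comment> \<open>Both ends lie in layer 0, so \<open>e\<close> is a multiple of
      \<open>w\<close>, and the same target is reached in whole rounds of \<open>m\<close>
      steps.\<close>
    then obtain e where e: "(F ^^ e) (fst ?u, 0) = (0, 0)" using F unfolding circulates_def by blast
    then have "e mod w = 0" using snd_pow[OF x', of e] by simp
    then obtain e' where "e = w * e'" by auto
    then have "(G ^^ (m * e')) ?u = (0, 0)" using rounds[OF x', of e'] e u by simp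
    then have "(G ^^ (m * e' + (m - j))) v = (0, 0)" by (simp add: funpow_add)
    then show "\<exists>e. (G ^^ e) v = (0, 0)" by blast
  qed (use n m0 in auto)
  then show ?thesis unfolding G_def .
qed

text \<open>Each of the four permutations gives one layered cycle, with its inverse in the backward
  layers. There the two partners merely change places, so all four steps \<open>a\<close>,
  \<open>- a\<close>, \<open>b\<close>, \<open>- b\<close> still occur once.\<close>

lemma circulant_layers:
  fixes n a b m :: nat
  assumes m: "2 \<le> m" and a: "0 < a" "2 * a < n" and b: "0 < b" "2 * b < n"
    and ab: "odd (a + b)" and gcd: "gcd (gcd a b) n = 1"
  obtains G1 G2 G3 G4 where "\<And>G. G \<in> {G1, G2, G3, G4} \<Longrightarrow> circulates G ({..<n} \<times> {..<m})"
    and "\<And>x j. x < n \<Longrightarrow> j < m \<Longrightarrow> mset [G1 (x, j), G2 (x, j), G3 (x, j), G4 (x, j)] =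
      mset (map (\<lambda>l. ((x + l) mod n, Suc j mod m)) [a, n - a, b, n - b])"
proof -
  define w :: nat where "w = (if even m then 2 else 1)"
  have w: "w = 1 \<or> w = 2" "0 < w" "w \<le> m" "even (m - w)" unfolding w_def using m by auto
  have n: "n > 0" using a by simp
  let ?V = "{..<n} \<times> {..<w}"
  obtain F1 F1' F2 F2' where F: "\<And>F. F \<in> {F1, F1', F2, F2'} \<Longrightarrow> circulates F ?V"
    "\<And>x. x \<in> ?V \<Longrightarrow> F1 (F1' x) = x \<and> F1' (F1 x) = x \<and> F2 (F2' x) = x \<and> F2' (F2 x) = x"
    "\<And>x y. x < n \<Longrightarrow> y < w \<Longrightarrow> mset [F1 (x, y), F1' (x, y), F2 (x, y), F2' (x, y)] =
      mset (map (\<lambda>l. ((x + l) mod n, Suc y mod w)) [a, n - a, b, n - b])"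
    by (rule circulant_hamilton_decomposition[OF w(1) a b ab gcd]) (rule that)
  have sndF: "snd (F (x, y)) = Suc y mod w" if "F \<in> {F1, F1', F2, F2'}" "(x, y) \<in> ?V" for F x y
  proof -
    have "F (x, y) \<in> set [F1 (x, y), F1' (x, y), F2 (x, y), F2' (x, y)]" using that(1) by auto
    then have "F (x, y) \<in> set (map (\<lambda>l. ((x + l) mod n, Suc y mod w)) [a, n - a, b, n - b])"
      using mset_eq_setD[OF F(3)[of x y]] that(2) by auto
    then show ?thesis by auto
  qed
  have lay: "circulates (layered w m F F') ({..<n} \<times> {..<m})"
    if "F \<in> {F1, F1', F2, F2'}" "F' \<in> {F1, F1', F2, F2'}" "\<And>v. v \<in> ?V \<Longrightarrow> F' (F v) = v" for F F'
  proof (rule layered_circulates[OF n w(2-4)])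
    show "circulates F ?V" "circulates F' ?V" using F(1) that(1,2) by blast+
    show "\<And>v. v \<in> ?V \<Longrightarrow> F' (F v) = v" by (rule that(3))
    show "\<And>x y. (x, y) \<in> ?V \<Longrightarrow> snd (F (x, y)) = Suc y mod w \<and> snd (F' (x, y)) = Suc y mod w"
      using sndF that(1,2) by blast
  qed
  show ?thesis
  proof (rule that)
    fix G assume "G \<in> {layered w m F1 F1', layered w m F1' F1, layered w m F2 F2', layered w m F2' F2}"
    then consider "G = layered w m F1 F1'" | "G = layered w m F1' F1" | "G = layered w m F2 F2'"
      | "G = layered w m F2' F2" by blast
    then show "circulates G ({..<n} \<times> {..<m})"
      by cases (simp only:, rule lay, simp, simp, simp only: F(2))+
  next
    fix x j assume x: "x < n" and "j < m"
    let ?y = "j mod w"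
    have y: "?y < w" using w by simp
    have "mset (map (\<lambda>u. (fst u, Suc j mod m)) [F1 (x, ?y), F1' (x, ?y), F2 (x, ?y), F2' (x, ?y)]) =
        mset (map (\<lambda>u. (fst u, Suc j mod m)) (map (\<lambda>l. ((x + l) mod n, Suc ?y mod w)) [a, n - a, b, n - b]))"
      unfolding mset_map[of "\<lambda>u. (fst u, Suc j mod m)"] F(3)[OF x y] ..
    also have "\<dots> = mset (map (\<lambda>l. ((x + l) mod n, Suc j mod m)) [a, n - a, b, n - b])" by simp
    finally have "mset (map (\<lambda>u. (fst u, Suc j mod m)) [F1 (x, ?y), F1' (x, ?y), F2 (x, ?y), F2' (x, ?y)]) =
        mset (map (\<lambda>l. ((x + l) mod n, Suc j mod m)) [a, n - a, b, n - b])" .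
    moreover have "mset [layered w m F1 F1' (x, j), layered w m F1' F1 (x, j), layered w m F2 F2' (x, j),
        layered w m F2' F2 (x, j)] =
        mset (map (\<lambda>u. (fst u, Suc j mod m)) [F1 (x, ?y), F1' (x, ?y), F2 (x, ?y), F2' (x, ?y)])"
      by (cases "j < w \<or> even (j - w)") (simp_all add: layered_def add_mset_commute)
    ultimately show "mset [layered w m F1 F1' (x, j), layered w m F1' F1 (x, j), layered w m F2 F2' (x, j),
        layered w m F2' F2 (x, j)] = mset (map (\<lambda>l. ((x + l) mod n, Suc j mod m)) [a, n - a, b, n - b])"
      by (rule trans[rotated])
  qed
qed

section \<open>Edges of the tensor product\<close>

text \<open>Containment of each cycle in the edge multiset follows from the sum condition and is
  dropped, so that decompositions of parts can be added.\<close>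

definition cycle_sum :: "'a set \<Rightarrow> 'a set multiset \<Rightarrow> bool" where
  "cycle_sum V M \<longleftrightarrow> (\<exists>D. (\<forall>C \<in># D. \<exists>vs. 2 \<le> length vs \<and> distinct vs \<and> set vs = V \<and>
     C = cycle_edges vs) \<and> \<Sum>\<^sub># D = M)"

lemma hamilton_decomposable_iff: "hamilton_decomposable G \<longleftrightarrow> cycle_sum (verts G) (edges G)"
proof -
  have sub: "C \<subseteq># \<Sum>\<^sub># D" if "C \<in># D" for C :: "'a set multiset" and D
    using that by (auto dest!: multi_member_split)
  have "(\<forall>C\<in>#D. hamilton_cycle G C) \<longleftrightarrow>
      (\<forall>C\<in>#D. \<exists>vs. 2 \<le> length vs \<and> distinct vs \<and> set vs = verts G \<and> C = cycle_edges vs)"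
    if "\<Sum>\<^sub># D = edges G" for D
    using sub[of _ D] unfolding that hamilton_cycle_def by blast
  then show ?thesis unfolding hamilton_decomposable_def cycle_sum_def by blast
qed

lemma cycle_sum_empty: "cycle_sum V {#}"
  unfolding cycle_sum_def by (rule exI[of _ "{#}"]) simp

lemma cycle_sum_cycle: "2 \<le> length vs \<Longrightarrow> distinct vs \<Longrightarrow> cycle_sum (set vs) (cycle_edges vs)"
  unfolding cycle_sum_def by (rule exI[of _ "{#cycle_edges vs#}"]) auto

lemma cycle_sum_add:
  assumes "cycle_sum V A" "cycle_sum V B"
  shows "cycle_sum V (A + B)"
proof -
  obtain D E where "\<forall>C \<in># D. \<exists>vs. 2 \<le> length vs \<and> distinct vs \<and> set vs = V \<and> C = cycle_edges vs" "\<Sum>\<^sub># D = A"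
    "\<forall>C \<in># E. \<exists>vs. 2 \<le> length vs \<and> distinct vs \<and> set vs = V \<and> C = cycle_edges vs" "\<Sum>\<^sub># E = B"
    using assms unfolding cycle_sum_def by blast
  then show ?thesis unfolding cycle_sum_def by (intro exI[of _ "D + E"]) auto
qed

lemma cycle_sum_sum: "(\<And>x. x \<in> A \<Longrightarrow> cycle_sum V (f x)) \<Longrightarrow> cycle_sum V (sum f A)"
  by (induction A rule: infinite_finite_induct) (auto intro: cycle_sum_empty cycle_sum_add)

lemma cycle_sum_sum_mset: "(\<And>x. x \<in># A \<Longrightarrow> cycle_sum V (f x)) \<Longrightarrow> cycle_sum V (\<Sum>x\<in>#A. f x)"
  by (induction A) (auto intro: cycle_sum_empty cycle_sum_add)

lemma cycle_sum_circulates: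
  assumes G: "circulates G W" and W: "finite W" "2 \<le> card W" and f: "inj_on f W"
  shows "cycle_sum (f ` W) (\<Sum>v\<in>W. {#{f v, f (G v)}#})"
proof -
  have "W \<noteq> {}" using W by auto
  then obtain vs where vs: "length vs = card W" "distinct vs" "set vs = W"
    "cycle_edges vs = {#{v, G v}. v \<in># mset_set W#}"
    using circulates_cycle_edges[OF G W(1)] by blast
  have "cycle_edges (map f vs) = image_mset (image f) (cycle_edges vs)"
    unfolding cycle_edges_def multiset.map_comp
  proof (simp, rule image_mset_cong)
    fix i assume "i \<in># mset_set {..<length vs}"
    then have i: "i < length vs" by simp
    then have "Suc i mod length vs < length vs" by (intro mod_less_divisor) auto
    with i show "{map f vs ! i, map f vs ! (Suc i mod length vs)} =
        (image f \<circ> (\<lambda>i. {vs ! i, vs ! (Suc i mod length vs)})) i" by simp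
  qed
  also have "\<dots> = (\<Sum>v\<in>W. {#{f v, f (G v)}#})"
    unfolding vs(4) by (simp add: multiset.map_comp comp_def sum_unfold_sum_mset)
  finally have "cycle_edges (map f vs) = (\<Sum>v\<in>W. {#{f v, f (G v)}#})" .
  moreover have "cycle_sum (set (map f vs)) (cycle_edges (map f vs))"
    by (rule cycle_sum_cycle) (use vs W f in \<open>auto simp: distinct_map\<close>)
  ultimately show ?thesis using vs by simp
qed

section \<open>Tensor products of edges, jumps and cycles\<close>

definition edge_tensor :: "'a set \<Rightarrow> 'b set \<Rightarrow> ('a \<times> 'b) set multiset" where
  "edge_tensor e f = mset_set {{(g1, h1), (g2, h2)} | g1 g2 h1 h2. e = {g1, g2} \<and> f = {h1, h2}}"

lemma edge_tensor_pair:
  assumes "x \<noteq> y" "u \<noteq> v"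
  shows "edge_tensor {x, y} {u, v} = {#{(x, u), (y, v)}#} + {#{(x, v), (y, u)}#}"
proof -
  have "{{(g1, h1), (g2, h2)} | g1 g2 h1 h2. {x, y} = {g1, g2} \<and> {u, v} = {h1, h2}} =
      {{(x, u), (y, v)}, {(x, v), (y, u)}}"
    by (auto simp: doubleton_eq_iff insert_commute)
  moreover have "{(x, u), (y, v)} \<noteq> {(x, v), (y, u)}"
    using assms by (auto simp: doubleton_eq_iff)
  ultimately show ?thesis unfolding edge_tensor_def by simp
qed

definition jump_tensor :: "nat \<Rightarrow> nat \<Rightarrow> 'b set multiset \<Rightarrow> (nat \<times> 'b) set multiset" where
  "jump_tensor n l C = (\<Sum>i<n. \<Sum>f\<in>#C. edge_tensor {i, (i + l) mod n} f)"

lemma add_mod_cancel: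
  fixes x y l n :: nat
  assumes "(x + l) mod n = (y + l) mod n"
  shows "x mod n = y mod n"
proof -
  have "(int x + int l) mod int n = (int y + int l) mod int n" using assms by (metis of_nat_add of_nat_mod)
  then have "int n dvd (int x - int y)" by (simp add: mod_eq_dvd_iff)
  then have "int x mod int n = int y mod int n" by (simp add: mod_eq_dvd_iff)
  then show ?thesis by (metis of_nat_eq_iff of_nat_mod)
qed

lemma bij_add_mod:
  fixes n l :: nat
  shows "bij_betw (\<lambda>i. (i + l) mod n) {..<n} {..<n}"
proof -
  have "inj_on (\<lambda>i. (i + l) mod n) {..<n}"
    by (rule inj_onI) (metis lessThan_iff mod_less add_mod_cancel)
  moreover have "(\<lambda>i. (i + l) mod n) ` {..<n} \<subseteq> {..<n}" by auto
  ultimately show ?thesis using endo_inj_surj[OF finite_lessThan] unfolding bij_betw_def by blast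
qed

text \<open>Orient all edges along \<open>vs\<close>. Of the two edges over
  \<open>{i, i + l}\<close> one is then a step by \<open>l\<close> from \<open>i\<close>, the other
  a step by \<open>- l\<close> from \<open>i + l\<close>; reindexing the latter gives the form in
  which \<open>circulant_layers\<close> lists its steps.\<close>

lemma jump_tensor_cycle:
  fixes n l :: nat
  assumes l: "0 < l" "l < n" and vs: "2 \<le> length vs" "distinct vs"
  shows "jump_tensor n l (cycle_edges vs) =
    (\<Sum>(i, j)\<in>{..<n} \<times> {..<length vs}.
       {#{(i, vs ! j), ((i + l) mod n, vs ! (Suc j mod length vs))}#} +
       {#{(i, vs ! j), ((i + (n - l)) mod n, vs ! (Suc j mod length vs))}#})"
proof -
  define m where "m = length vs"
  define s where "s j = Suc j mod m" for j
  have ne: "i \<noteq> (i + l) mod n" if "i < n" for i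
  proof
    assume "i = (i + l) mod n"
    then have "(0 + i) mod n = (l + i) mod n" using that by (simp add: add.commute)
    then have "0 mod n = l mod n" by (rule add_mod_cancel)
    then show False using l by simp
  qed
  have sj: "vs ! j \<noteq> vs ! s j" if "j < m" for j
  proof -
    have "s j < m" "s j \<noteq> j" using that vs unfolding s_def m_def by (auto simp: mod_Suc)
    then show ?thesis using that vs unfolding m_def by (simp add: nth_eq_iff_index_eq)
  qed
  have "jump_tensor n l (cycle_edges vs) =
      (\<Sum>i<n. \<Sum>j<m. edge_tensor {i, (i + l) mod n} {vs ! j, vs ! s j})"
    unfolding jump_tensor_def cycle_edges_def m_def s_def
    by (simp add: multiset.map_comp comp_def sum_unfold_sum_mset)
  also have "\<dots> = (\<Sum>i<n. \<Sum>j<m. {#{(i, vs ! j), ((i + l) mod n, vs ! s j)}#} +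
      {#{(i, vs ! s j), ((i + l) mod n, vs ! j)}#})"
    by (intro sum.cong refl edge_tensor_pair ne sj) simp_all
  also have "\<dots> = (\<Sum>j<m. \<Sum>i<n. {#{(i, vs ! j), ((i + l) mod n, vs ! s j)}#}) +
      (\<Sum>j<m. \<Sum>i<n. {#{(i, vs ! s j), ((i + l) mod n, vs ! j)}#})"
    by (subst sum.swap) (simp only: sum.distrib)
  also have "(\<Sum>j<m. \<Sum>i<n. {#{(i, vs ! s j), ((i + l) mod n, vs ! j)}#}) =
      (\<Sum>j<m. \<Sum>i<n. {#{(i, vs ! j), ((i + (n - l)) mod n, vs ! s j)}#})"
  proof (rule sum.cong[OF refl])
    fix j
    let ?f = "\<lambda>i. {#{(i, vs ! j), ((i + (n - l)) mod n, vs ! s j)}#}"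
    have "sum ?f {..<n} = (\<Sum>i<n. ?f ((i + l) mod n))"
      by (rule sum.reindex_bij_betw[symmetric, OF bij_add_mod])
    also have "\<dots> = (\<Sum>i<n. {#{(i, vs ! s j), ((i + l) mod n, vs ! j)}#})"
    proof (rule sum.cong[OF refl])
      fix i assume i: "i \<in> {..<n}"
      have "((i + l) mod n + (n - l)) mod n = (i + l + (n - l)) mod n" by (rule mod_add_left_eq)
      also have "\<dots> = i" using i l by simp
      finally show "?f ((i + l) mod n) = {#{(i, vs ! s j), ((i + l) mod n, vs ! j)}#}"
        by (simp add: insert_commute)
    qed
    finally show "(\<Sum>i<n. {#{(i, vs ! s j), ((i + l) mod n, vs ! j)}#}) = sum ?f {..<n}" ..
  qed
  also have "(\<Sum>j<m. \<Sum>i<n. {#{(i, vs ! j), ((i + l) mod n, vs ! s j)}#}) +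
      (\<Sum>j<m. \<Sum>i<n. {#{(i, vs ! j), ((i + (n - l)) mod n, vs ! s j)}#}) =
      (\<Sum>i<n. \<Sum>j<m. {#{(i, vs ! j), ((i + l) mod n, vs ! s j)}#} +
        {#{(i, vs ! j), ((i + (n - l)) mod n, vs ! s j)}#})"
    by (subst (3) sum.swap) (simp only: sum.distrib)
  finally show ?thesis unfolding m_def s_def by (simp add: sum.cartesian_product)
qed

lemma cycle_sum_jump_pair:
  fixes n a b :: nat
  assumes a: "0 < a" "2 * a < n" and b: "0 < b" "2 * b < n"
    and ab: "odd (a + b)" and gcd: "gcd (gcd a b) n = 1"
    and vs: "2 \<le> length vs" "distinct vs"
  shows "cycle_sum ({..<n} \<times> set vs) (jump_tensor n a (cycle_edges vs) + jump_tensor n b (cycle_edges vs))"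
proof -
  define m where "m = length vs"
  define f where "f = (\<lambda>(i::nat, j). (i, vs ! j))"
  let ?W = "{..<n} \<times> {..<m}"
  obtain G1 G2 G3 G4 where G: "\<And>G. G \<in> {G1, G2, G3, G4} \<Longrightarrow> circulates G ?W"
    "\<And>x j. x < n \<Longrightarrow> j < m \<Longrightarrow> mset [G1 (x, j), G2 (x, j), G3 (x, j), G4 (x, j)] =
      mset (map (\<lambda>l. ((x + l) mod n, Suc j mod m)) [a, n - a, b, n - b])"
    by (rule circulant_layers[OF vs(1)[folded m_def] a b ab gcd]) (rule that)
  have inj: "inj_on f ?W"
    using vs unfolding inj_on_def f_def m_def by (auto simp: nth_eq_iff_index_eq)
  have img: "f ` ?W = {..<n} \<times> set vs"
    unfolding f_def m_def by (force simp: in_set_conv_nth image_iff)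
  have "2 \<le> n * m" using a vs unfolding m_def by (metis dual_order.trans mult_le_mono1 nat_mult_1 less_one linorder_not_le mult_0_right not_less0)
  then have W: "finite ?W" "2 \<le> card ?W" by simp_all
  have cyc: "cycle_sum ({..<n} \<times> set vs) (\<Sum>v\<in>?W. {#{f v, f (G v)}#})" if "G \<in> {G1, G2, G3, G4}" for G
    using cycle_sum_circulates[OF G(1)[OF that] W inj] img by simp
  have "cycle_sum ({..<n} \<times> set vs) ((\<Sum>v\<in>?W. {#{f v, f (G1 v)}#}) + (\<Sum>v\<in>?W. {#{f v, f (G2 v)}#}) +
      (\<Sum>v\<in>?W. {#{f v, f (G3 v)}#}) + (\<Sum>v\<in>?W. {#{f v, f (G4 v)}#}))"
    by (intro cycle_sum_add cyc) simp_all
  also have "(\<Sum>v\<in>?W. {#{f v, f (G1 v)}#}) + (\<Sum>v\<in>?W. {#{f v, f (G2 v)}#}) +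
      (\<Sum>v\<in>?W. {#{f v, f (G3 v)}#}) + (\<Sum>v\<in>?W. {#{f v, f (G4 v)}#}) =
      (\<Sum>v\<in>?W. {#{f v, f (G1 v)}#} + {#{f v, f (G2 v)}#} + {#{f v, f (G3 v)}#} + {#{f v, f (G4 v)}#})"
    by (simp only: sum.distrib)
  also have "\<dots> = jump_tensor n a (cycle_edges vs) + jump_tensor n b (cycle_edges vs)"
  proof -
    have "{#{f (x, j), f (G1 (x, j))}#} + {#{f (x, j), f (G2 (x, j))}#} + {#{f (x, j), f (G3 (x, j))}#} +
        {#{f (x, j), f (G4 (x, j))}#} =
        ({#{(x, vs ! j), ((x + a) mod n, vs ! (Suc j mod m))}#} +
        {#{(x, vs ! j), ((x + (n - a)) mod n, vs ! (Suc j mod m))}#}) +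
        ({#{(x, vs ! j), ((x + b) mod n, vs ! (Suc j mod m))}#} +
        {#{(x, vs ! j), ((x + (n - b)) mod n, vs ! (Suc j mod m))}#})" (is "?lhs = ?rhs")
      if "x < n" "j < m" for x j
    proof -
      have "image_mset (\<lambda>u. {f (x, j), f u}) (mset [G1 (x, j), G2 (x, j), G3 (x, j), G4 (x, j)]) =
        image_mset (\<lambda>u. {f (x, j), f u}) (mset (map (\<lambda>l. ((x + l) mod n, Suc j mod m)) [a, n - a, b, n - b]))"
        unfolding G(2)[OF that] ..
      moreover have "image_mset (\<lambda>u. {f (x, j), f u}) (mset [G1 (x, j), G2 (x, j), G3 (x, j), G4 (x, j)]) = ?lhs"
        by simp
      moreover have "image_mset (\<lambda>u. {f (x, j), f u})
          (mset (map (\<lambda>l. ((x + l) mod n, Suc j mod m)) [a, n - a, b, n - b])) = ?rhs"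
        by (simp add: f_def)
      ultimately show ?thesis by simp
    qed
    then have "(\<Sum>v\<in>?W. {#{f v, f (G1 v)}#} + {#{f v, f (G2 v)}#} + {#{f v, f (G3 v)}#} + {#{f v, f (G4 v)}#}) =
        (\<Sum>(x, j)\<in>?W. ({#{(x, vs ! j), ((x + a) mod n, vs ! (Suc j mod m))}#} +
        {#{(x, vs ! j), ((x + (n - a)) mod n, vs ! (Suc j mod m))}#}) +
        ({#{(x, vs ! j), ((x + b) mod n, vs ! (Suc j mod m))}#} +
        {#{(x, vs ! j), ((x + (n - b)) mod n, vs ! (Suc j mod m))}#}))"
      by (intro sum.cong refl) (simp only: split_paired_all prod.case mem_Sigma_iff lessThan_iff)
    also have "\<dots> = jump_tensor n a (cycle_edges vs) + jump_tensor n b (cycle_edges vs)"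
    proof -
      have an: "a < n" and bn: "b < n" using a b by simp_all
      show ?thesis unfolding jump_tensor_cycle[OF a(1) an vs] jump_tensor_cycle[OF b(1) bn vs] m_def
        by (simp only: split_def sum.distrib)
    qed
    finally show ?thesis .
  qed
  finally show ?thesis .
qed

text \<open>A jump with \<open>2 * l = n\<close> leads from vertex 0 to one vertex only, so together
  with \<open>l'\<close> the degree of 0 would be at most 3.\<close>

lemma regular_four_jumps:
  assumes L: "l \<in> {1..n div 2}" "l' \<in> {1..n div 2}" and reg: "regular_graph 4 (circ n {l, l'})"
  shows "2 * l < n"
proof (rule ccontr)
  assume "\<not> 2 * l < n"
  then have nl: "n = 2 * l" using L by auto
  have l0: "0 < l" "0 < n" using L nl by auto
  define E where "E = {{i, (i + l'') mod n} | i l''. i < n \<and> l'' \<in> {l, l'}}"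
  have "E = (\<lambda>(i, l''). {i, (i + l'') mod n}) ` ({..<n} \<times> {l, l'})" unfolding E_def by auto
  then have fin: "finite E" by simp
  have "vertex_degree (circ n {l, l'}) 0 = 4"
    using reg l0 unfolding regular_graph_def circ_def by simp
  then have card: "card {e \<in> E. 0 \<in> e} = 4"
    unfolding vertex_degree_def circ_def E_def[symmetric] using fin by (simp add: filter_mset_mset_set)
  have "e \<in> {{0, l}, {0, l'}, {0, n - l'}}" if e: "e \<in> E" "0 \<in> e" for e
  proof -
    obtain i l'' where i: "e = {i, (i + l'') mod n}" "i < n" "l'' \<in> {l, l'}" using e unfolding E_def by blast
    have l'': "0 < l''" "l'' < n" "l' \<le> n" using i L nl by auto
    have "i = 0 \<or> (i + l'') mod n = 0" using e i by auto
    then show ?thesis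
    proof
      assume "i = 0"
      then show ?thesis using i l'' by auto
    next
      assume z: "(i + l'') mod n = 0"
      then obtain d where "i + l'' = n * d" by auto
      moreover have "0 < i + l''" "i + l'' < n * 2" using l'' i by auto
      ultimately have "d = 1" using l0 by (metis One_nat_def Suc_1 bot_nat_0.not_eq_extremum less_Suc0 less_antisym mult_0_right mult_less_cancel1 nat_neq_iff)
      then have "i = n - l''" using \<open>i + l'' = n * d\<close> by simp
      then show ?thesis using i z nl by (auto simp: insert_commute)
    qed
  qed
  then have "{e \<in> E. 0 \<in> e} \<subseteq> {{0, l}, {0, l'}, {0, n - l'}}" by blast
  then have "card {e \<in> E. 0 \<in> e} \<le> card {{0, l}, {0, l'}, {0, n - l'}}" by (intro card_mono) auto
  also have "\<dots> \<le> 3" by (simp add: card_insert_if)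
  finally show False using card by simp
qed

text \<open>The multiples of this gcd are closed under adjacency and contain 0, so connectedness
  puts 1 among them.\<close>

lemma connected_circ_gcd:
  assumes n: "2 \<le> n" and con: "connected_graph (circ n {l, l'})"
  shows "gcd (gcd l l') n = 1"
proof -
  let ?d = "gcd (gcd l l') n"
  have d: "?d dvd l" "?d dvd l'" "?d dvd n" using dvd_trans[OF gcd_dvd1] by auto
  define S where "S = {(x, y). {x, y} \<in># edges (circ n {l, l'})}"
  have "(0, 1) \<in> S\<^sup>*" using con n unfolding connected_graph_def S_def circ_def by simp
  moreover have "?d dvd y" if "(0, y) \<in> S\<^sup>*" for y
    using that
  proof (induction)
    case (step y z)
    have "finite {{i, (i + l'') mod n} | i l''. i < n \<and> l'' \<in> {l, l'}}"
      by (rule finite_subset[of _ "(\<lambda>(i, l''). {i, (i + l'') mod n}) ` ({..<n} \<times> {l, l'})"]) auto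
    then obtain i l'' where i: "{y, z} = {i, (i + l'') mod n}" "l'' \<in> {l, l'}"
      using step(2) unfolding S_def circ_def by auto
    have "?d dvd (i + l'') mod n \<longleftrightarrow> ?d dvd i + l''" using d(3) by (simp add: dvd_mod_iff)
    also have "\<dots> \<longleftrightarrow> ?d dvd i" using d i(2) by (auto simp: dvd_add_left_iff)
    finally show ?case using i(1) step(3) by (auto simp: doubleton_eq_iff)
  qed simp
  ultimately have "?d dvd 1" by blast
  then show ?thesis by simp
qed

text \<open>The edges of \<open>circ\<close> are given as a set. For jumps shorter than half of
  \<open>n\<close> each edge comes from a unique pair \<open>(l, i)\<close>, so the sum over pairs
  does not count it twice, as it would for \<open>2 * l = n\<close>.\<close>

lemma circ_edges:
  assumes L: "\<And>l. l \<in> L \<Longrightarrow> 0 < l \<and> 2 * l < n"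
  shows "edges (circ n L) = (\<Sum>l\<in>L. \<Sum>i<n. {#{i, (i + l) mod n}#})"
proof -
  have fin: "finite L" by (rule finite_subset[of _ "{..<n}"]) (use L in fastforce)+
  let ?f = "\<lambda>(l, i). {i, (i + l) mod n}"
  have "inj_on ?f (L \<times> {..<n})"
  proof (rule inj_onI)
    fix u v assume "u \<in> L \<times> {..<n}" "v \<in> L \<times> {..<n}" "?f u = ?f v"
    then obtain l i l' i' where uv: "u = (l, i)" "v = (l', i')"
      and a: "l \<in> L" "i \<in> {..<n}" "l' \<in> L" "i' \<in> {..<n}" "{i, (i + l) mod n} = {i', (i' + l') mod n}"
      by auto
    have m: "(x + y) mod n = x + y \<or> (x + y) mod n + n = x + y" if "x < n" "2 * y < n" for x y
      using that by (auto simp: mod_if)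
    have bounds: "0 < l" "2 * l < n" "0 < l'" "2 * l' < n" "i < n" "i' < n" using a L by auto
    define A B where AB: "A = (i + l) mod n" "B = (i' + l') mod n"
    have "A = i + l \<or> A + n = i + l" "B = i' + l' \<or> B + n = i' + l'"
      unfolding AB using m bounds by blast+
    moreover have "i = i' \<and> A = B \<or> i = B \<and> A = i'" using a(5) unfolding AB doubleton_eq_iff by blast
    ultimately have "l = l' \<and> i = i'" using bounds by (elim disjE conjE; intro conjI; linarith)
    then show "u = v" using uv by simp
  qed
  moreover have "{{i, (i + l) mod n} | i l. i < n \<and> l \<in> L} = ?f ` (L \<times> {..<n})" by auto
  ultimately have "edges (circ n L) = image_mset ?f (mset_set (L \<times> {..<n}))"
    unfolding circ_def by (simp add: image_mset_mset_set)
  also have "\<dots> = (\<Sum>(l, i)\<in>L \<times> {..<n}. {#{i, (i + l) mod n}#})"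
    by (simp add: sum_unfold_sum_mset split_def)
  finally show ?thesis by (simp add: sum.cartesian_product)
qed

lemma sum_mset_image_sum:
  "(\<Sum>e\<in>#sum M A. g e) = (\<Sum>x\<in>A. \<Sum>e\<in>#M x. g e)"
  by (induction A rule: infinite_finite_induct) auto

lemma tensor_circ_edges:
  assumes L: "\<And>l. l \<in> L \<Longrightarrow> 0 < l \<and> 2 * l < n" and D: "edges H = \<Sum>\<^sub># D"
  shows "edges (tensor (circ n L) H) = (\<Sum>C\<in>#D. \<Sum>l\<in>L. jump_tensor n l C)"
proof -
  have "edges (tensor (circ n L) H) = (\<Sum>e\<in>#edges (circ n L). \<Sum>f\<in>#edges H. edge_tensor e f)"
    unfolding tensor_def edge_tensor_def by simp
  also have "\<dots> = (\<Sum>l\<in>L. jump_tensor n l (edges H))"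
  proof -
    have "edges (circ n L) = (\<Sum>l\<in>L. \<Sum>i<n. {#{i, (i + l) mod n}#})" by (rule circ_edges) (rule L)
    then show ?thesis unfolding jump_tensor_def by (simp add: sum_mset_image_sum)
  qed
  also have "\<dots> = (\<Sum>C\<in>#D. \<Sum>l\<in>L. jump_tensor n l C)"
    unfolding D by (induction D) (simp_all add: jump_tensor_def sum.distrib)
  finally show ?thesis .
qed

theorem theorem1p4:
  fixes n :: nat and L :: "nat set" and H :: "'b multigraph"
  assumes "n \<ge> 1" and "L \<subseteq> {1..n div 2}"
    and "property_Q n L"
    and "loopless_multigraph H"
    and "hamilton_decomposable H"
  shows "hamilton_decomposable (tensor (circ n L) H)"
proof -
  let ?O = "{l \<in> L. odd l}"
  obtain p where p: "bij_betw p ?O {l \<in> L. even l}"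
    and reg: "\<And>l. l \<in> ?O \<Longrightarrow> regular_graph 4 (circ n {l, p l})"
    and con: "\<And>l. l \<in> ?O \<Longrightarrow> connected_graph (circ n {l, p l})"
    using assms(3) unfolding property_Q_def by blast
  have pe: "p l \<in> L" "even (p l)" if "l \<in> ?O" for l using bij_betwE[OF p] that by auto
  have odd_jump: "0 < l \<and> 2 * l < n \<and> 0 < p l \<and> 2 * p l < n" if l: "l \<in> ?O" for l
  proof -
    have in_range: "l \<in> {1..n div 2}" "p l \<in> {1..n div 2}" using l pe[OF l] assms(2) by auto
    have "regular_graph 4 (circ n {p l, l})" using reg[OF l] by (simp add: insert_commute)
    then show ?thesis
      using regular_four_jumps[OF in_range reg[OF l]] regular_four_jumps[OF in_range(2,1)] in_range by auto
  qed
  have jump: "0 < l \<and> 2 * l < n" if l: "l \<in> L" for l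
  proof (cases "even l")
    case True
    then obtain l' where "l' \<in> ?O" "l = p l'" using l p unfolding bij_betw_def by blast
    then show ?thesis using odd_jump by blast
  qed (use l odd_jump in blast)
  obtain D where D: "\<And>C. C \<in># D \<Longrightarrow> hamilton_cycle H C" "edges H = \<Sum>\<^sub># D"
    using assms(5) unfolding hamilton_decomposable_def by metis
  have fin: "finite L" using assms(2) finite_subset by blast
  have pairs: "(\<Sum>l\<in>L. jump_tensor n l C) = (\<Sum>l\<in>?O. jump_tensor n l C + jump_tensor n (p l) C)" for C :: "'b set multiset"
  proof -
    have "L = ?O \<union> {l \<in> L. even l}" by auto
    then have "(\<Sum>l\<in>L. jump_tensor n l C) = (\<Sum>l\<in>?O. jump_tensor n l C) + (\<Sum>l\<in>{l \<in> L. even l}. jump_tensor n l C)"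
      using fin by (metis (no_types, lifting) sum.union_disjoint finite_Un disjoint_iff mem_Collect_eq)
    also have "(\<Sum>l\<in>{l \<in> L. even l}. jump_tensor n l C) = (\<Sum>l\<in>?O. jump_tensor n (p l) C)"
      using sum.reindex_bij_betw[OF p, of "\<lambda>l. jump_tensor n l C"] by simp
    finally show ?thesis by (simp add: sum.distrib)
  qed
  have "cycle_sum ({..<n} \<times> verts H) (jump_tensor n l C + jump_tensor n (p l) C)"
    if C: "C \<in># D" and l: "l \<in> ?O" for C l
  proof -
    obtain vs where vs: "2 \<le> length vs" "distinct vs" "set vs = verts H" "C = cycle_edges vs"
      using D(1)[OF C] unfolding hamilton_cycle_def by blast
    have n2: "2 \<le> n" using odd_jump[OF l] by linarith
    have "odd (l + p l)" using l pe[OF l] by simp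
    then show ?thesis
      using cycle_sum_jump_pair[of l n "p l" vs] odd_jump[OF l] connected_circ_gcd[OF n2 con[OF l]] vs by simp
  qed
  then have "cycle_sum ({..<n} \<times> verts H) (\<Sum>C\<in>#D. \<Sum>l\<in>?O. jump_tensor n l C + jump_tensor n (p l) C)"
    by (intro cycle_sum_sum_mset cycle_sum_sum)
  moreover have "edges (tensor (circ n L) H) = (\<Sum>C\<in>#D. \<Sum>l\<in>L. jump_tensor n l C)"
    by (rule tensor_circ_edges) (use jump D in auto)
  ultimately have "cycle_sum ({..<n} \<times> verts H) (edges (tensor (circ n L) H))"
    by (simp only: pairs)
  moreover have "verts (tensor (circ n L) H) = {..<n} \<times> verts H" unfolding tensor_def circ_def by simp
  ultimately show ?thesis unfolding hamilton_decomposable_iff by simp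
qed

end
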